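(* Let $T>0$, let $f:\mathbb{R}\to\mathbb{R}$ be Lipschitz with $f(0)=0$ and such that $f'(0)$ exists, let $u_0\in BV(\mathbb{R})\cap L^1(\mathbb{R})$ be nonnegative, and let $x_0^1<\dots<x_0^N$ be real numbers. Let $v$, $v_0$ and $A$ be the approximation, initial approximation and interpolated velocity field of the particle path scheme (see context), and put $v_k=v-k$, $v_{0,k}=v_0-k$. Then $$\int_0^T\int_{\mathbb{R}}|v_k|\,\partial_t\varphi+(Av-f(k))\operatorname{sgn}(v_k)\,\partial_x\varphi\,dx\,dt-\int_{\mathbb{R}}\varphi(x,T)\,|v_k(x,T)|\,dx+\int_{\mathbb{R}}\varphi(x,0)\,|v_{0,k}(x)|\,dx\ge0$$ for all $k\ge0$ and all nonnegative $\varphi\in C_c^\infty(\mathbb{R}\times[0,T])$.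
   Context: $\chi_I$ is the indicator function of $I$; $\operatorname{sgn}$ is the sign function with $\operatorname{sgn}(0)=0$. Velocity function: $a(v)=f(v)/v$ for $v\ne0$, $a(0)=f'(0)$; $V(v_l,v_r)=\min_{v\in[v_l,v_r]}a(v)$ if $0\le v_l\le v_r$, and $V(v_l,v_r)=\max_{v\in[v_r,v_l]}a(v)$ if $0\le v_r\le v_l$. Particle path scheme. Initialization: set $x_0^0=-\infty$, $x_0^{N+1}=+\infty$, $v_0^i=\frac{1}{x_0^{i+1}-x_0^i}\int_{x_0^i}^{x_0^{i+1}}u_0\,dx$ for $1\le i\le N-1$, $v_0^0=v_0^N=0$, and $v_0(x)=\sum_{i=0}^N v_0^i\chi_{(x_0^i,x_0^{i+1})}(x)$. For all $t$ put $x_t^0=-\infty$, $x_t^{N+1}=+\infty$, $v_t^0=v_t^N=0$. Stages: $t_0=0$, $\mathcal{I}_0=\{1,\dots,N\}$. At stage $j$, with time $t_j<T$, remaining index set $\mathcal{I}_j\ni N$, $N_j=|\mathcal{I}_j|$, let $\pi_j:\{1,\dots,N_j\}\to\mathcal{I}_j$ be the increasing bijection, extended by $\pi_j(0)=0$, $\pi_j(N_j+1)=N+1$. On $(t_j,t_{j+1})$ the positions $x_t^{\pi_j(i)}$, $1\le i\le N_j$, are $C^1$, strictly increasing in $i$, and solve $\dot x_t^{\pi_j(i)}=V(v_t^{\pi_j(i-1)},v_t^{\pi_j(i)})$ with the values at $t_j$ as initial data, where for $1\le i\le N_j-1$ $$v_t^{\pi_j(i)}=\frac{x_{t_j}^{\pi_j(i+1)}-x_{t_j}^{\pi_j(i)}}{x_t^{\pi_j(i+1)}-x_t^{\pi_j(i)}}\,v_{t_j}^{\pi_j(i)}.$$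 Here $t_{j+1}\in(t_j,T]$ is the first time at which two or more particles meet, or $T$ if there is no such time before $T$. Values at $t_{j+1}$ are limits as $t\uparrow t_{j+1}$. Put $\mathcal{I}_{j+1}=\{\pi_j(i): 1\le i\le N_j,\ x_{t_{j+1}}^{\pi_j(i)}\ne x_{t_{j+1}}^{\pi_j(i+1)}\}$ (the leftmost particles of each collision and their densities are deleted), define $N_{j+1},\pi_{j+1}$ accordingly, and continue from $t_{j+1}$ with the remaining particles and densities; stop when $t_{j+1}=T$. There are finitely many stages, and the solutions on each stage exist and are unique. Approximation: $v(x,t)=\sum_{i=0}^{N_j}v_t^{\pi_j(i)}\chi_{(x_t^{\pi_j(i)},x_t^{\pi_j(i+1)})}(x)$ for $t\in[t_j,t_{j+1})$, and with the final index set at $t=T$. Velocity field: for $t\in[t_j,t_{j+1})$ (and at $t=T$ with the final index set), $$A(x,t)=\frac{x_t^{\pi_j(i+1)}-x}{x_t^{\pi_j(i+1)}-x_t^{\pi_j(i)}}V(v_t^{\pi_j(i-1)},v_t^{\pi_j(i)})+\frac{x-x_t^{\pi_j(i)}}{x_t^{\pi_j(i+1)}-x_t^{\pi_j(i)}}V(v_t^{\pi_j(i)},v_t^{\pi_j(i+1)})$$ for $x\in[x_t^{\pi_j(i)},x_t^{\pi_j(i+1)}]$, $1\le i\le N_j-1$, and $A(\cdot,t)$ is constant to the left of the first and to the right of the last remaining particle, with the value of $V$ at that particle. *)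

theory Defs
  imports "HOL-Analysis.Analysis"
begin

text \<open>\<open>BV(\<real>)\<close> in the sense of functions modulo null sets: \<open>u\<close> is locally integrable and the
  functional \<open>\<psi> \<mapsto> \<integral> u \<psi>'\<close> is bounded on the \<open>\<psi> \<in> C\<^sub>c\<^sup>1(\<real>)\<close> with \<open>\<bar>\<psi>\<bar> \<le> 1\<close>.\<close>

definition BV :: "(real \<Rightarrow> real) \<Rightarrow> bool" where
  "BV u \<longleftrightarrow>
     (\<forall>a b. set_integrable lebesgue {a..b} u) \<and>
     (\<exists>C. \<forall>\<psi> \<psi>'.
        (\<forall>x. (\<psi> has_real_derivative \<psi>' x) (at x)) \<and> continuous_on UNIV \<psi>' \<and>
        compact (closure {x. \<psi> x \<noteq> 0}) \<and> (\<forall>x. \<bar>\<psi> x\<bar> \<le> 1)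
        \<longrightarrow> (LINT x|lebesgue. u x * \<psi>' x) \<le> C)"

text \<open>\<open>\<phi> \<in> C\<^sub>c\<^sup>\<infinity>(\<real> \<times> [0,T])\<close>, smooth up to the boundary lines \<open>t = 0\<close> and \<open>t = T\<close>, on which \<open>\<phi>\<close>
  need not vanish. \<open>D m n\<close> is the partial derivative \<open>\<partial>\<^sub>x\<^sup>m \<partial>\<^sub>t\<^sup>n \<phi>\<close>, one-sided in \<open>t\<close> on these lines.
  Values of \<open>\<phi>\<close> at times outside \<open>[0,T]\<close> are irrelevant.\<close>

definition test_function :: "real \<Rightarrow> (real \<Rightarrow> real \<Rightarrow> real) \<Rightarrow> bool" where
  "test_function T \<phi> \<longleftrightarrow>
     compact (closure {(x, t). t \<in> {0..T} \<and> \<phi> x t \<noteq> 0}) \<and>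
     (\<exists>D :: nat \<Rightarrow> nat \<Rightarrow> real \<Rightarrow> real \<Rightarrow> real.
        (\<forall>x. \<forall>t\<in>{0..T}. D 0 0 x t = \<phi> x t) \<and>
        (\<forall>m n. continuous_on (UNIV \<times> {0..T}) (\<lambda>(x, t). D m n x t)) \<and>
        (\<forall>m n x. \<forall>t\<in>{0..T}.
           ((\<lambda>y. D m n y t) has_real_derivative D (Suc m) n x t) (at x) \<and>
           ((\<lambda>s. D m n x s) has_real_derivative D m (Suc n) x t) (at t within {0..T})))"

definition speed :: "(real \<Rightarrow> real) \<Rightarrow> real \<Rightarrow> real" where
  "speed f v = (if v = 0 then deriv f 0 else f v / v)"

text \<open>Here \<open>f\<close> is continuous, \<open>f 0 = 0\<close> and \<open>f'(0)\<close> exists, so \<open>speed f\<close> is continuous and the infimum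
  and supremum over the compact interval are attained. Used for nonnegative arguments only.\<close>

definition velocity :: "(real \<Rightarrow> real) \<Rightarrow> real \<Rightarrow> real \<Rightarrow> real" where
  "velocity f vl vr =
     (if vl \<le> vr then (INF v\<in>{vl..vr}. speed f v) else (SUP v\<in>{vr..vl}. speed f v))"

text \<open>The positions \<open>x\<^sup>i\<close>, \<open>1 \<le> i \<le> N\<close>, with the conventions \<open>x\<^sup>0 = -\<infinity>\<close> and \<open>x\<^bsup>N+1\<^esup> = +\<infinity>\<close>.\<close>

definition ext_pos :: "nat \<Rightarrow> (nat \<Rightarrow> real) \<Rightarrow> nat \<Rightarrow> ereal" where
  "ext_pos N x i = (if i = 0 then -\<infinity> else if i \<le> N then ereal (x i) else \<infinity>)"

text \<open>The increasing bijection \<open>\<pi> : {1..card J} \<rightarrow> J\<close>, with \<open>\<pi>(0) = 0\<close> and \<open>\<pi>(card J + 1) = N + 1\<close>.\<close>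

definition idx :: "nat \<Rightarrow> nat set \<Rightarrow> nat \<Rightarrow> nat" where
  "idx N J i =
     (if i = 0 then 0 else if i \<le> card J then sorted_list_of_set J ! (i - 1) else Suc N)"

text \<open>The piecewise constant function given by positions \<open>x\<close> and densities \<open>w\<close> of the particles in \<open>J\<close>.\<close>

definition profile :: "nat \<Rightarrow> nat set \<Rightarrow> (nat \<Rightarrow> real) \<Rightarrow> (nat \<Rightarrow> real) \<Rightarrow> real \<Rightarrow> real" where
  "profile N J x w y =
     (\<Sum>i = 0..card J. w (idx N J i) *
        indicator {z. ext_pos N x (idx N J i) < ereal z \<and>
                      ereal z < ext_pos N x (idx N J (Suc i))} y)"

definition init_density :: "nat \<Rightarrow> (nat \<Rightarrow> real) \<Rightarrow> (real \<Rightarrow> real) \<Rightarrow> nat \<Rightarrow> real" where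
  "init_density N p u\<^sub>0 i =
     (if 1 \<le> i \<and> i \<le> N - 1
      then 1 / (p (i + 1) - p i) * (LINT x:{p i..p (i + 1)}|lebesgue. u\<^sub>0 x) else 0)"

text \<open>One stage of the scheme on \<open>[s,e]\<close>, with index sets \<open>J\<close> on the stage and \<open>J'\<close> after it;
  \<open>X i t\<close> and \<open>W i t\<close> are the position and density of particle \<open>i\<close> at time \<open>t\<close>. Continuity on
  \<open>{s..e}\<close> encodes both the initial data at \<open>s\<close> and the values at \<open>e\<close> as left limits. Densities of
  particles that are deleted at \<open>e\<close> get no value there.\<close>

definition scheme_stage ::
  "(real \<Rightarrow> real) \<Rightarrow> real \<Rightarrow> nat \<Rightarrow> (nat \<Rightarrow> real \<Rightarrow> real) \<Rightarrow> (nat \<Rightarrow> real \<Rightarrow> real) \<Rightarrow>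
   real \<Rightarrow> real \<Rightarrow> nat set \<Rightarrow> nat set \<Rightarrow> bool" where
  "scheme_stage f T N X W s e J J' \<longleftrightarrow>
     (let n = card J; \<pi> = idx N J in
        s < e \<and> e \<le> T \<and>
        (\<forall>i\<in>{1..n}. continuous_on {s..e} (X (\<pi> i)) \<and>
                     X (\<pi> i) C1_differentiable_on {s<..<e}) \<and>
        (\<forall>i\<in>{1..n}. \<forall>t\<in>{s<..<e}.
           (X (\<pi> i) has_real_derivative velocity f (W (\<pi> (i - 1)) t) (W (\<pi> i) t)) (at t)) \<and>
        (\<forall>i\<in>{1..<n}. \<forall>t\<in>{s<..<e}.
           X (\<pi> i) t < X (\<pi> (i + 1)) t \<and>
           W (\<pi> i) t = (X (\<pi> (i + 1)) s - X (\<pi> i) s) / (X (\<pi> (i + 1)) t - X (\<pi> i) t)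
                         * W (\<pi> i) s) \<and>
        (e = T \<or> (\<exists>i\<in>{1..<n}. X (\<pi> i) e = X (\<pi> (i + 1)) e)) \<and>
        J' = {\<pi> i | i. i \<in> {1..n} \<and>
               ext_pos N (\<lambda>k. X k e) (\<pi> i) \<noteq> ext_pos N (\<lambda>k. X k e) (\<pi> (i + 1))} \<and>
        (\<forall>k\<in>J'. (W k \<longlongrightarrow> W k e) (at_left e)))"

text \<open>A complete run of the particle path scheme with \<open>M\<close> stages: \<open>\<tau> j\<close> and \<open>I j\<close> are \<open>t\<^sub>j\<close> and the
  index set of stage \<open>j\<close>, for \<open>j \<le> M\<close>; \<open>I M\<close> is the final index set, in force at time \<open>T\<close> only.
  The value of \<open>X i t\<close> or \<open>W i t\<close> after the deletion of particle \<open>i\<close> is irrelevant.\<close>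

definition particle_path_scheme ::
  "(real \<Rightarrow> real) \<Rightarrow> real \<Rightarrow> nat \<Rightarrow> (nat \<Rightarrow> real) \<Rightarrow> (real \<Rightarrow> real) \<Rightarrow>
   nat \<Rightarrow> (nat \<Rightarrow> real) \<Rightarrow> (nat \<Rightarrow> nat set) \<Rightarrow>
   (nat \<Rightarrow> real \<Rightarrow> real) \<Rightarrow> (nat \<Rightarrow> real \<Rightarrow> real) \<Rightarrow> bool" where
  "particle_path_scheme f T N p u\<^sub>0 M \<tau> I X W \<longleftrightarrow>
     \<tau> 0 = 0 \<and> \<tau> M = T \<and> I 0 = {1..N} \<and>
     (\<forall>i\<in>{1..N}. X i 0 = p i) \<and>
     (\<forall>i\<in>{0..N}. W i 0 = init_density N p u\<^sub>0 i) \<and>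
     (\<forall>t\<in>{0..T}. W 0 t = 0 \<and> W N t = 0) \<and>
     (\<forall>j<M. scheme_stage f T N X W (\<tau> j) (\<tau> (Suc j)) (I j) (I (Suc j)))"

text \<open>The \<open>j\<close> with \<open>t \<in> [t\<^sub>j, t\<^bsub>j+1\<^esub>)\<close>, and \<open>M\<close> for \<open>t = T\<close>.\<close>

definition stage_of :: "nat \<Rightarrow> (nat \<Rightarrow> real) \<Rightarrow> real \<Rightarrow> nat" where
  "stage_of M \<tau> t = Max {j. j \<le> M \<and> \<tau> j \<le> t}"

definition approximation ::
  "nat \<Rightarrow> nat \<Rightarrow> (nat \<Rightarrow> real) \<Rightarrow> (nat \<Rightarrow> nat set) \<Rightarrow>
   (nat \<Rightarrow> real \<Rightarrow> real) \<Rightarrow> (nat \<Rightarrow> real \<Rightarrow> real) \<Rightarrow> real \<Rightarrow> real \<Rightarrow> real" where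
  "approximation N M \<tau> I X W x t =
     profile N (I (stage_of M \<tau> t)) (\<lambda>i. X i t) (\<lambda>i. W i t) x"

text \<open>The interpolated velocity. At an interior particle both adjacent cells contain \<open>y\<close>; their formulas
  agree there, so taking the leftmost cell is immaterial.\<close>

definition interpolated_velocity ::
  "(real \<Rightarrow> real) \<Rightarrow> nat \<Rightarrow> nat set \<Rightarrow> (nat \<Rightarrow> real) \<Rightarrow> (nat \<Rightarrow> real) \<Rightarrow> real \<Rightarrow> real" where
  "interpolated_velocity f N J x w y =
     (let n = card J; \<pi> = idx N J;
          V = (\<lambda>i. velocity f (w (\<pi> (i - 1))) (w (\<pi> i)))
      in if y \<le> x (\<pi> 1) then V 1
         else if x (\<pi> n) \<le> y then V n
         else (let i = (LEAST i. 1 \<le> i \<and> i \<le> n - 1 \<and> y \<in> {x (\<pi> i)..x (\<pi> (i + 1))})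
               in (x (\<pi> (i + 1)) - y) / (x (\<pi> (i + 1)) - x (\<pi> i)) * V i +
                  (y - x (\<pi> i)) / (x (\<pi> (i + 1)) - x (\<pi> i)) * V (i + 1)))"

definition velocity_field ::
  "(real \<Rightarrow> real) \<Rightarrow> nat \<Rightarrow> nat \<Rightarrow> (nat \<Rightarrow> real) \<Rightarrow> (nat \<Rightarrow> nat set) \<Rightarrow>
   (nat \<Rightarrow> real \<Rightarrow> real) \<Rightarrow> (nat \<Rightarrow> real \<Rightarrow> real) \<Rightarrow> real \<Rightarrow> real \<Rightarrow> real" where
  "velocity_field f N M \<tau> I X W x t =
     interpolated_velocity f N (I (stage_of M \<tau> t)) (\<lambda>i. X i t) (\<lambda>i. W i t) x"

end

theory Submission
  imports Defs
begin

text \<open>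
  The inequality is an exact entropy balance, cell by cell, in which the only terms left over have a
  sign. Let a cell lie between two neighbouring particles \<open>z < y\<close> with velocities \<open>V\<^sub>1, V\<^sub>2\<close> and carry
  the density \<open>w = m / (y - z)\<close>; the mass \<open>m\<close> is constant during a stage. The interpolated velocity \<open>A\<close>
  is exactly the velocity of the points \<open>\<zeta> = z + (y - z) \<sigma>\<close> that keep their relative place
  \<open>\<sigma> \<in> [0,1]\<close> in the cell. In the coordinate \<open>\<sigma>\<close> the entropy in the cell is
  \<open>H(t) = \<bar>q\<bar> \<integral>\<^sub>0\<^sup>1 \<phi>(\<zeta>, t) d\<sigma>\<close> with \<open>q = m - k (y - z)\<close>, and the space integral over the cell in the
  asserted inequality equals
  \<open>H' + sgn (w - k) ((k V\<^sub>2 - f k) \<phi>(y, t) - (k V\<^sub>1 - f k) \<phi>(z, t))\<close>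
  (\<open>cell_integral_eq\<close>, \<open>has_integral_cell_entropy\<close>).

  Summed over all cells, the boundary terms collect at the particles. The particle between the
  densities \<open>a\<close> and \<open>b\<close> contributes
  \<open>\<phi> (k V(a, b) - f k) (sgn (a - k) - sgn (b - k))\<close>, and this is nonnegative: the signs differ only
  if \<open>k\<close> lies between \<open>a\<close> and \<open>b\<close>, and then \<open>V(a, b)\<close>, a minimum or a maximum of \<open>f(v) / v\<close>, is on
  the right side of \<open>f(k) / k\<close> (\<open>velocity_entropy\<close>). The two unbounded outer cells have density \<open>0\<close>;
  they are cut off at a distance where the test function vanishes and behave like cells of mass \<open>0\<close>.

  The coordinate \<open>\<sigma>\<close> also settles what happens at a collision. The density of a collapsing cell may
  blow up, but \<open>q\<close>, \<open>H\<close> and the space integral stay bounded up to the collision time, and \<open>H\<close> is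
  continuous there. Deleting the cell drops a nonnegative term \<open>H\<close>. Hence every stage contributes at
  least the difference of the total entropies at its two ends (\<open>stage_entropy_inequality\<close>), and these
  differences telescope to the two terms at \<open>t = T\<close> and \<open>t = 0\<close>.
\<close>

section \<open>Integrating the derivative of an absolute value\<close>

text \<open>The zeros of \<open>q\<close>, where \<open>\<bar>q\<bar>\<close> need not be differentiable, are circumvented by replacing
  \<open>\<bar>x\<bar>\<close> by \<open>\<eta> n x = sqrt (x\<^sup>2 + 1 / (n + 1))\<close>, whose derivative
  \<open>x / \<eta> n x\<close> is bounded by \<open>1\<close> and tends to \<open>sgn x\<close> everywhere, at \<open>0\<close> too. So the fundamental
  theorem of calculus for \<open>\<eta> n (q t) * \<Psi> t\<close> passes to the limit by dominated convergence.\<close>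

lemma has_integral_abs_mult:
  fixes q \<Psi> q' \<Psi>' :: "real \<Rightarrow> real"
  assumes "s \<le> e" and cq: "continuous_on {s..e} q" and c\<Psi>: "continuous_on {s..e} \<Psi>"
    and dq: "\<And>t. t \<in> {s<..<e} \<Longrightarrow> (q has_real_derivative q' t) (at t)"
    and d\<Psi>: "\<And>t. t \<in> {s<..<e} \<Longrightarrow> (\<Psi> has_real_derivative \<Psi>' t) (at t)"
    and bq: "\<And>t. t \<in> {s..e} \<Longrightarrow> \<bar>q' t\<bar> \<le> B" and b\<Psi>: "\<And>t. t \<in> {s..e} \<Longrightarrow> \<bar>\<Psi>' t\<bar> \<le> B"
  shows "((\<lambda>t. sgn (q t) * q' t * \<Psi> t + \<bar>q t\<bar> * \<Psi>' t) has_integral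
           (\<bar>q e\<bar> * \<Psi> e - \<bar>q s\<bar> * \<Psi> s)) {s..e}"
proof -
  define \<eta> :: "nat \<Rightarrow> real \<Rightarrow> real" where "\<eta> n x = sqrt (x\<^sup>2 + 1 / real (Suc n))" for n x
  have \<eta>_pos: "\<eta> n x > 0" for n x
    unfolding \<eta>_def by (intro real_sqrt_gt_zero add_nonneg_pos) auto
  have \<eta>_ge: "\<bar>x\<bar> \<le> \<eta> n x" for n x
    unfolding \<eta>_def by (rule real_le_rsqrt) auto
  have \<eta>_le: "\<eta> n x \<le> \<bar>x\<bar> + 1" for n x
  proof -
    have "1 / real (Suc n) \<le> 1" by simp
    then have "x\<^sup>2 + 1 / real (Suc n) \<le> (\<bar>x\<bar> + 1)\<^sup>2"
      unfolding power2_sum using abs_ge_zero[of x] by (simp del: of_nat_Suc; linarith)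
    then show ?thesis unfolding \<eta>_def by (intro real_le_lsqrt) auto
  qed
  have lim_\<eta>: "(\<lambda>n. \<eta> n x) \<longlonglongrightarrow> \<bar>x\<bar>" for x
  proof -
    have "(\<lambda>n. sqrt (x\<^sup>2 + 1 / real (Suc n))) \<longlonglongrightarrow> sqrt (x\<^sup>2 + 0)"
      by (intro tendsto_intros LIMSEQ_Suc[OF lim_1_over_n])
    then show ?thesis unfolding \<eta>_def by simp
  qed
  have d\<eta>: "(\<eta> n has_real_derivative x / \<eta> n x) (at x)" for n x
  proof -
    have pos: "x\<^sup>2 + 1 / real (Suc n) > 0" by (intro add_nonneg_pos) auto
    have "((\<lambda>x. x\<^sup>2 + 1 / real (Suc n)) has_real_derivative 2 * x) (at x)"
      using DERIV_add[OF DERIV_power[OF DERIV_ident, of 2] DERIV_const[of "1 / real (Suc n)"]] by simp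
    from DERIV_chain2[OF DERIV_real_sqrt[OF pos] this]
    have "((\<lambda>x. \<eta> n x) has_real_derivative inverse (\<eta> n x) / 2 * (2 * x)) (at x)"
      unfolding \<eta>_def .
    moreover have "inverse (\<eta> n x) / 2 * (2 * x) = x / \<eta> n x"
      using \<eta>_pos[of n x] by (simp add: field_simps)
    ultimately show ?thesis by metis
  qed
  obtain Q where Q: "\<And>t. t \<in> {s..e} \<Longrightarrow> \<bar>q t\<bar> \<le> Q"
    using compact_imp_bounded[OF compact_continuous_image[OF cq compact_Icc]]
    unfolding bounded_iff image_iff real_norm_def by blast
  obtain P where P: "\<And>t. t \<in> {s..e} \<Longrightarrow> \<bar>\<Psi> t\<bar> \<le> P"
    using compact_imp_bounded[OF compact_continuous_image[OF c\<Psi> compact_Icc]]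
    unfolding bounded_iff image_iff real_norm_def by blast
  let ?h = "\<lambda>n t. q t / \<eta> n (q t) * q' t * \<Psi> t + \<eta> n (q t) * \<Psi>' t"
  show ?thesis
  proof (rule has_integral_dominated_convergence[where f = ?h and h = "\<lambda>_. B * P + (Q + 1) * B"
        and y = "\<lambda>n. \<eta> n (q e) * \<Psi> e - \<eta> n (q s) * \<Psi> s"])
    fix n
    show "(?h n has_integral \<eta> n (q e) * \<Psi> e - \<eta> n (q s) * \<Psi> s) {s..e}"
    proof (rule fundamental_theorem_of_calculus_interior[OF \<open>s \<le> e\<close>, where f = "\<lambda>t. \<eta> n (q t) * \<Psi> t"])
      show "continuous_on {s..e} (\<lambda>t. \<eta> n (q t) * \<Psi> t)"
        unfolding \<eta>_def by (intro continuous_intros cq c\<Psi>)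
      fix t assume t: "t \<in> {s<..<e}"
      show "((\<lambda>t. \<eta> n (q t) * \<Psi> t) has_vector_derivative ?h n t) (at t)"
        unfolding has_real_derivative_iff_has_vector_derivative[symmetric]
        using DERIV_mult[OF DERIV_chain2[OF d\<eta> dq[OF t]] d\<Psi>[OF t]] by (simp add: mult.commute)
    qed
    show "\<forall>t\<in>{s..e}. norm (?h n t) \<le> B * P + (Q + 1) * B"
    proof
      fix t assume t: "t \<in> {s..e}"
      have B: "B \<ge> 0" using bq[OF t] by auto
      have 1: "\<bar>q t / \<eta> n (q t)\<bar> \<le> 1" using \<eta>_ge[of "q t" n] \<eta>_pos[of n "q t"]
        by (simp add: field_simps)
      have "\<bar>q t / \<eta> n (q t) * q' t * \<Psi> t\<bar> \<le> 1 * B * P"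
        unfolding abs_mult by (intro mult_mono 1 bq[OF t] P[OF t] mult_nonneg_nonneg) (use B in auto)
      moreover have "\<bar>\<eta> n (q t) * \<Psi>' t\<bar> \<le> (Q + 1) * B"
        unfolding abs_mult using \<eta>_pos[of n "q t"] \<eta>_le[of n "q t"] Q[OF t]
        by (intro mult_mono b\<Psi>[OF t]) auto
      ultimately show "norm (?h n t) \<le> B * P + (Q + 1) * B" unfolding real_norm_def by linarith
    qed
  next
    have "(\<lambda>n. q t / \<eta> n (q t)) \<longlonglongrightarrow> sgn (q t)" for t
    proof (cases "q t = 0")
      case False
      have "(\<lambda>n. q t / \<eta> n (q t)) \<longlonglongrightarrow> q t / \<bar>q t\<bar>"
        using False by (intro tendsto_intros lim_\<eta>) auto
      then show ?thesis by (simp add: real_sgn_eq)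
    qed simp
    then show "\<forall>t\<in>{s..e}. (\<lambda>n. ?h n t) \<longlonglongrightarrow> sgn (q t) * q' t * \<Psi> t + \<bar>q t\<bar> * \<Psi>' t"
      by (intro ballI tendsto_intros lim_\<eta>)
    show "(\<lambda>n. \<eta> n (q e) * \<Psi> e - \<eta> n (q s) * \<Psi> s) \<longlonglongrightarrow> \<bar>q e\<bar> * \<Psi> e - \<bar>q s\<bar> * \<Psi> s"
      by (intro tendsto_intros lim_\<eta>)
  qed auto
qed

section \<open>Test functions on the strip\<close>

text \<open>What the weak formulation uses of a nonnegative test function. The time derivative is one-sided on
  the lines \<open>t = 0\<close> and \<open>t = T\<close>, where \<open>\<phi>\<close> need not vanish.\<close>

locale strip_test_function =
  fixes T :: real and \<phi> \<phi>x \<phi>t :: "real \<Rightarrow> real \<Rightarrow> real" and R :: real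
  assumes cont_\<phi>: "continuous_on (UNIV \<times> {0..T}) (\<lambda>(x, t). \<phi> x t)"
    and cont_\<phi>x: "continuous_on (UNIV \<times> {0..T}) (\<lambda>(x, t). \<phi>x x t)"
    and cont_\<phi>t: "continuous_on (UNIV \<times> {0..T}) (\<lambda>(x, t). \<phi>t x t)"
    and deriv_x: "t \<in> {0..T} \<Longrightarrow> ((\<lambda>y. \<phi> y t) has_real_derivative \<phi>x x t) (at x)"
    and deriv_t: "t \<in> {0..T} \<Longrightarrow> ((\<lambda>s. \<phi> x s) has_real_derivative \<phi>t x t) (at t within {0..T})"
    and vanish: "t \<in> {0..T} \<Longrightarrow> R \<le> \<bar>x\<bar> \<Longrightarrow> \<phi> x t = 0 \<and> \<phi>x x t = 0 \<and> \<phi>t x t = 0"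
    and nonneg: "t \<in> {0..T} \<Longrightarrow> 0 \<le> \<phi> x t"
begin

lemma bounded_derivs:
  obtains K where "K \<ge> 0" "\<And>x t. t \<in> {0..T} \<Longrightarrow> \<bar>\<phi> x t\<bar> \<le> K"
    "\<And>x t. t \<in> {0..T} \<Longrightarrow> \<bar>\<phi>x x t\<bar> \<le> K" "\<And>x t. t \<in> {0..T} \<Longrightarrow> \<bar>\<phi>t x t\<bar> \<le> K"
proof -
  have bdd: "\<exists>K. \<forall>x. \<forall>t\<in>{0..T}. \<bar>g x t\<bar> \<le> K"
    if c: "continuous_on (UNIV \<times> {0..T}) (\<lambda>(x, t). g x t)"
      and 0: "\<And>x t. t \<in> {0..T} \<Longrightarrow> R \<le> \<bar>x\<bar> \<Longrightarrow> g x t = 0" for g :: "real \<Rightarrow> real \<Rightarrow> real"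
  proof -
    have "compact ((\<lambda>(x, t). g x t) ` ({-R..R} \<times> {0..T}))"
      by (intro compact_continuous_image continuous_on_subset[OF c] compact_Times) auto
    then obtain K where "\<forall>z\<in>{-R..R} \<times> {0..T}. \<bar>case z of (x, t) \<Rightarrow> g x t\<bar> \<le> K"
      by (auto dest!: compact_imp_bounded simp: bounded_iff)
    then have K: "\<And>x t. x \<in> {-R..R} \<Longrightarrow> t \<in> {0..T} \<Longrightarrow> \<bar>g x t\<bar> \<le> K"
      by auto
    have "\<bar>g x t\<bar> \<le> max K 0" if "t \<in> {0..T}" for x t
    proof (cases "R \<le> \<bar>x\<bar>")
      case True then show ?thesis using 0[OF that] by simp
    next
      case False
      then have "x \<in> {-R..R}" by auto
      then show ?thesis using K[OF _ that, of x] by linarith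
    qed
    then show ?thesis by blast
  qed
  obtain K1 where K1: "\<And>x t. t \<in> {0..T} \<Longrightarrow> \<bar>\<phi> x t\<bar> \<le> K1"
    using bdd[OF cont_\<phi>] vanish by blast
  obtain K2 where K2: "\<And>x t. t \<in> {0..T} \<Longrightarrow> \<bar>\<phi>x x t\<bar> \<le> K2"
    using bdd[OF cont_\<phi>x] vanish by blast
  obtain K3 where K3: "\<And>x t. t \<in> {0..T} \<Longrightarrow> \<bar>\<phi>t x t\<bar> \<le> K3"
    using bdd[OF cont_\<phi>t] vanish by blast
  show ?thesis
    by (rule that[of "max 0 (max K1 (max K2 K3))"]) (simp_all add: le_max_iff_disj K1 K2 K3)
qed

text \<open>Continuous partial derivatives make \<open>\<phi>\<close> totally differentiable on the strip, so the chain rule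
  applies along a moving point. For interior times the strip is a neighbourhood in time.\<close>

lemma deriv_along_path:
  assumes \<zeta>: "(\<zeta> has_real_derivative a) (at t)" and t: "t \<in> {0<..<T}"
  shows "((\<lambda>r. \<phi> (\<zeta> r) r) has_real_derivative \<phi>x (\<zeta> t) t * a + \<phi>t (\<zeta> t) t) (at t)"
proof -
  have t': "t \<in> {0..T}" using t by auto
  have "((\<lambda>(x, r). \<phi> x r) has_derivative
      (\<lambda>(dx, dr). \<phi>x (\<zeta> t) t * dx + blinfun_mult_right (\<phi>t (\<zeta> t) t) dr))
      (at (\<zeta> t, t) within UNIV \<times> {0..T})"
  proof (rule has_derivative_partialsI)
    show "((\<lambda>x. \<phi> x t) has_derivative (*) (\<phi>x (\<zeta> t) t)) (at (\<zeta> t) within UNIV)"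
      using deriv_x[OF t', of "\<zeta> t"] by (simp add: has_field_derivative_def)
    show "((\<lambda>y. \<phi> x y) has_derivative blinfun_apply (blinfun_mult_right (\<phi>t x y))) (at y within {0..T})"
      if "y \<in> {0..T}" for x y
      using deriv_t[OF that, of x] by (simp add: has_field_derivative_def)
    have "continuous_on (UNIV \<times> {0..T}) (\<lambda>z. blinfun_mult_right (case z of (x, t) \<Rightarrow> \<phi>t x t))"
      by (intro bounded_linear.continuous_on[OF bounded_linear_blinfun_mult_right] cont_\<phi>t)
    then show "continuous (at (\<zeta> t, t) within UNIV \<times> {0..T}) (\<lambda>(x, y). blinfun_mult_right (\<phi>t x y))"
      using t' by (auto simp: continuous_on_eq_continuous_within split_beta')
  qed (use t' in auto)
  then have D: "((\<lambda>(x, r). \<phi> x r) has_derivative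
      (\<lambda>(dx, dr). \<phi>x (\<zeta> t) t * dx + \<phi>t (\<zeta> t) t * dr))
      (at (\<zeta> t, t) within UNIV \<times> {0..T})" by simp
  have "(\<lambda>(x, r). \<phi> x r) \<circ> (\<lambda>r. (\<zeta> r, r)) = (\<lambda>r. \<phi> (\<zeta> r) r)" by auto
  moreover have "((\<lambda>(x, r). \<phi> x r) \<circ> (\<lambda>r. (\<zeta> r, r)) has_derivative
      (\<lambda>(dx, dr). \<phi>x (\<zeta> t) t * dx + \<phi>t (\<zeta> t) t * dr) \<circ> (\<lambda>h. (a * h, h))) (at t within {0<..<T})"
  proof (rule diff_chain_within)
    show "((\<lambda>r. (\<zeta> r, r)) has_derivative (\<lambda>h. (a * h, h))) (at t within {0<..<T})"
      using has_derivative_Pair[OF has_derivative_at_withinI[OF \<zeta>[unfolded has_field_derivative_def]] has_derivative_ident] .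
    show "((\<lambda>(x, r). \<phi> x r) has_derivative
      (\<lambda>(dx, dr). \<phi>x (\<zeta> t) t * dx + \<phi>t (\<zeta> t) t * dr))
      (at (\<zeta> t, t) within (\<lambda>r. (\<zeta> r, r)) ` {0<..<T})"
      by (rule has_derivative_subset[OF D]) auto
  qed
  moreover have "(\<lambda>(dx, dr). \<phi>x (\<zeta> t) t * dx + \<phi>t (\<zeta> t) t * dr) \<circ> (\<lambda>h. (a * h, h)) =
      (*) (\<phi>x (\<zeta> t) t * a + \<phi>t (\<zeta> t) t)"
    by (rule ext) (simp add: distrib_right)
  ultimately show ?thesis
    using t at_within_open[of t "{0<..<T}"] unfolding has_field_derivative_def by simp
qed

end

section \<open>The entropy balance of one moving cell\<close>

text \<open>Passage to the relative coordinate \<open>\<sigma>\<close> in a cell.\<close>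

lemma set_integral_Icc_rescale:
  fixes h :: "real \<Rightarrow> real"
  assumes "z < y" and h: "continuous_on {z..y} h"
  shows "(LBINT x:{z..y}. h x) = (y - z) * integral {0..1} (\<lambda>\<sigma>. h (z + (y - z) * \<sigma>))"
proof -
  have c: "continuous_on {0..1} (\<lambda>\<sigma>. h (z + (y - z) * \<sigma>))"
  proof (rule continuous_on_compose2[OF h])
    show "(\<lambda>\<sigma>. z + (y - z) * \<sigma>) ` {0..1} \<subseteq> {z..y}"
    proof safe
      fix \<sigma> :: real assume "\<sigma> \<in> {0..1}"
      then have "0 \<le> (y - z) * \<sigma>" "(y - z) * \<sigma> \<le> (y - z) * 1"
        using \<open>z < y\<close> by (auto intro!: mult_left_mono)
      then show "z + (y - z) * \<sigma> \<in> {z..y}" by simp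
    qed
  qed (intro continuous_intros)
  have "(LBINT x:{z..y}. h x) =
      (y - z) * (LBINT \<sigma>. indicator {z..y} (z + (y - z) * \<sigma>) *\<^sub>R h (z + (y - z) * \<sigma>))"
    unfolding set_lebesgue_integral_def
    using lborel_integral_real_affine[of "y - z" "\<lambda>x. indicator {z..y} x *\<^sub>R h x" z] \<open>z < y\<close> by simp
  also have "(\<lambda>\<sigma>. indicator {z..y} (z + (y - z) * \<sigma>) *\<^sub>R h (z + (y - z) * \<sigma>)) =
      (\<lambda>\<sigma>. indicator {0..1} \<sigma> *\<^sub>R h (z + (y - z) * \<sigma>))"
  proof
    fix \<sigma> :: real
    have "z + (y - z) * \<sigma> \<in> {z..y} \<longleftrightarrow> 0 \<le> (y - z) * \<sigma> \<and> (y - z) * \<sigma> \<le> (y - z) * 1" by auto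
    also have "\<dots> \<longleftrightarrow> \<sigma> \<in> {0..1}"
      using \<open>z < y\<close> by (simp add: zero_le_mult_iff del: mult_1_right)
    finally show "indicator {z..y} (z + (y - z) * \<sigma>) *\<^sub>R h (z + (y - z) * \<sigma>) =
      indicator {0..1} \<sigma> *\<^sub>R h (z + (y - z) * \<sigma>)" by (simp add: indicator_def)
  qed
  also have "(LBINT \<sigma>. indicator {0..1} \<sigma> *\<^sub>R h (z + (y - z) * \<sigma>)) =
      integral {0..1} (\<lambda>\<sigma>. h (z + (y - z) * \<sigma>))"
    using set_borel_integral_eq_integral(2)[OF borel_integrable_atLeastAtMost'[OF c]]
    unfolding set_lebesgue_integral_def .
  finally show ?thesis .
qed

lemma abs_integral_unit_le:
  fixes h :: "real \<Rightarrow> real"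
  assumes "continuous_on {0..1} h" "\<And>\<sigma>. \<sigma> \<in> {0..1} \<Longrightarrow> \<bar>h \<sigma>\<bar> \<le> C"
  shows "\<bar>integral {0..1} h\<bar> \<le> C"
  using integral_bound[of 0 1 h C] assms by simp

lemma abs_sgn_mult_le: "\<bar>sgn a * b\<bar> \<le> \<bar>b\<bar>" for a b :: real
  by (simp add: abs_mult abs_sgn_eq)

context strip_test_function
begin

lemma continuous_on_at_time:
  assumes "t \<in> {0..T}"
  shows "continuous_on S (\<lambda>x. \<phi> x t)" "continuous_on S (\<lambda>x. \<phi>x x t)" "continuous_on S (\<lambda>x. \<phi>t x t)"
proof -
  have p: "continuous_on S (\<lambda>x. (x, t))" "(\<lambda>x. (x, t)) ` S \<subseteq> UNIV \<times> {0..T}"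
    using assms by (auto intro!: continuous_intros)
  show "continuous_on S (\<lambda>x. \<phi> x t)" "continuous_on S (\<lambda>x. \<phi>x x t)" "continuous_on S (\<lambda>x. \<phi>t x t)"
    using continuous_on_compose2[OF cont_\<phi> p] continuous_on_compose2[OF cont_\<phi>x p]
      continuous_on_compose2[OF cont_\<phi>t p] by simp_all
qed

end

text \<open>A cell between two moving points. The points may meet at the final time \<open>e\<close>: their order is
  assumed only in the lemmas that return to the space coordinate. The velocities are bounded by \<open>L\<close>
  for all times, including the endpoints, where they are not tied to the motion.\<close>

locale moving_cell = strip_test_function +
  fixes s e :: real and z y V1 V2 :: "real \<Rightarrow> real" and L m k c :: real
  assumes s_nonneg: "0 \<le> s" and s_less_e: "s < e" and e_le_T: "e \<le> T"
    and cont_z: "continuous_on {s..e} z" and cont_y: "continuous_on {s..e} y"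
    and deriv_z: "t \<in> {s<..<e} \<Longrightarrow> (z has_real_derivative V1 t) (at t)"
    and deriv_y: "t \<in> {s<..<e} \<Longrightarrow> (y has_real_derivative V2 t) (at t)"
    and cont_V1: "continuous_on {s<..<e} V1" and cont_V2: "continuous_on {s<..<e} V2"
    and V1_le: "\<bar>V1 t\<bar> \<le> L" and V2_le: "\<bar>V2 t\<bar> \<le> L"
begin

definition point :: "real \<Rightarrow> real \<Rightarrow> real" where
  "point t \<sigma> = z t + (y t - z t) * \<sigma>"

definition speed_at :: "real \<Rightarrow> real \<Rightarrow> real" where
  "speed_at t \<sigma> = V1 t + (V2 t - V1 t) * \<sigma>"

text \<open>The mass of the cell in excess of the mass that the density \<open>k\<close> would give. For a nonempty cell
  of density \<open>w = m / (y t - z t)\<close> this is \<open>(w - k) (y t - z t)\<close>; unlike \<open>w\<close> it remains bounded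
  when the cell collapses.\<close>

definition excess :: "real \<Rightarrow> real" where
  "excess t = m - k * (y t - z t)"

definition mean_test :: "real \<Rightarrow> real" where
  "mean_test t = integral {0..1} (\<lambda>\<sigma>. \<phi> (point t \<sigma>) t)"

definition mean_test_deriv :: "real \<Rightarrow> real" where
  "mean_test_deriv t =
     integral {0..1} (\<lambda>\<sigma>. \<phi>x (point t \<sigma>) t * speed_at t \<sigma> + \<phi>t (point t \<sigma>) t)"

text \<open>The contribution of the cell to the space integral of the weak formulation, in the relative
  coordinate; see \<open>cell_integral_eq_space_integral\<close>. The constant \<open>c\<close> stands for \<open>f k\<close>.\<close>

definition cell_integral :: "real \<Rightarrow> real" where
  "cell_integral t = \<bar>excess t\<bar> * integral {0..1} (\<lambda>\<sigma>. \<phi>t (point t \<sigma>) t) +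
     sgn (excess t) *
       integral {0..1} (\<lambda>\<sigma>. (m * speed_at t \<sigma> - c * (y t - z t)) * \<phi>x (point t \<sigma>) t)"

text \<open>What the cell sends through its two ends in a frame moving with the particles.\<close>

definition boundary_flux :: "real \<Rightarrow> real" where
  "boundary_flux t = sgn (excess t) *
     ((k * V2 t - c) * \<phi> (y t) t - (k * V1 t - c) * \<phi> (z t) t)"

lemma times: "t \<in> {s..e} \<Longrightarrow> t \<in> {0..T}" "t \<in> {s<..<e} \<Longrightarrow> t \<in> {0..T}"
  "t \<in> {s<..<e} \<Longrightarrow> t \<in> {0<..<T}"
  using s_nonneg e_le_T by auto

lemma continuous_on_point:
  assumes "S \<subseteq> {s..e}"
  shows "continuous_on (S \<times> U) (\<lambda>(t, \<sigma>). point t \<sigma>)"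
proof -
  have "continuous_on (S \<times> U) (\<lambda>p. z (fst p))" "continuous_on (S \<times> U) (\<lambda>p. y (fst p))"
    using assms by (auto intro!: continuous_on_compose2[OF cont_z] continuous_on_compose2[OF cont_y]
        continuous_intros)
  then show ?thesis unfolding point_def split_beta by (intro continuous_intros)
qed

lemma continuous_on_along:
  assumes "continuous_on (UNIV \<times> {0..T}) (\<lambda>(x, t). h x t)" "S \<subseteq> {s..e}"
  shows "continuous_on (S \<times> U) (\<lambda>(t, \<sigma>). h (point t \<sigma>) t)"
proof -
  have "continuous_on (S \<times> U) (\<lambda>p. (point (fst p) (snd p), fst p))"
    using continuous_on_point[OF assms(2), of U] by (intro continuous_intros) (simp add: split_beta)
  moreover have "(\<lambda>p. (point (fst p) (snd p), fst p)) ` (S \<times> U) \<subseteq> UNIV \<times> {0..T}"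
    using assms(2) s_nonneg e_le_T by fastforce
  ultimately show ?thesis
    using continuous_on_compose2[OF assms(1), of "S \<times> U" "\<lambda>p. (point (fst p) (snd p), fst p)"]
    by (simp add: split_beta)
qed

lemma continuous_on_speed_at: "continuous_on ({s<..<e} \<times> U) (\<lambda>(t, \<sigma>). speed_at t \<sigma>)"
proof -
  have "continuous_on ({s<..<e} \<times> U) (\<lambda>p. V1 (fst p))" "continuous_on ({s<..<e} \<times> U) (\<lambda>p. V2 (fst p))"
    by (auto intro!: continuous_on_compose2[OF cont_V1] continuous_on_compose2[OF cont_V2]
        continuous_intros)
  then show ?thesis unfolding speed_at_def split_beta by (intro continuous_intros)
qed

lemma continuous_on_slice:
  assumes "t \<in> {s..e}"
  shows "continuous_on U (\<lambda>\<sigma>. \<phi> (point t \<sigma>) t)" "continuous_on U (\<lambda>\<sigma>. \<phi>x (point t \<sigma>) t)"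
    "continuous_on U (\<lambda>\<sigma>. \<phi>t (point t \<sigma>) t)" "continuous_on U (speed_at t)"
proof -
  have p: "continuous_on U (point t)" unfolding point_def by (intro continuous_intros)
  note c = continuous_on_at_time[OF times(1)[OF assms], of UNIV]
  show "continuous_on U (\<lambda>\<sigma>. \<phi> (point t \<sigma>) t)" "continuous_on U (\<lambda>\<sigma>. \<phi>x (point t \<sigma>) t)"
    "continuous_on U (\<lambda>\<sigma>. \<phi>t (point t \<sigma>) t)"
    by (rule continuous_on_compose2[OF c(1) p] continuous_on_compose2[OF c(2) p]
        continuous_on_compose2[OF c(3) p]; simp)+
  show "continuous_on U (speed_at t)" unfolding speed_at_def by (intro continuous_intros)
qed

lemma abs_speed_at_le: "\<sigma> \<in> {0..1} \<Longrightarrow> \<bar>speed_at t \<sigma>\<bar> \<le> 3 * L"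
proof -
  assume \<sigma>: "\<sigma> \<in> {0..1}"
  have "\<bar>(V2 t - V1 t) * \<sigma>\<bar> \<le> (2 * L) * 1"
    unfolding abs_mult using \<sigma> V1_le[of t] V2_le[of t] by (intro mult_mono) auto
  then show ?thesis unfolding speed_at_def using V1_le[of t] by linarith
qed

lemma mean_test_nonneg: "t \<in> {s..e} \<Longrightarrow> 0 \<le> mean_test t"
  unfolding mean_test_def
  by (intro integral_nonneg integrable_continuous_interval continuous_on_slice nonneg times(1)) auto

lemma continuous_on_mean_test: "continuous_on {s..e} mean_test"
  unfolding mean_test_def cbox_interval[symmetric]
  by (intro integral_continuous_on_param continuous_on_along cont_\<phi>) simp

text \<open>Since the points at fixed \<open>\<sigma>\<close> move with the interpolated velocity, differentiation under the
  integral produces the transport derivative of \<open>\<phi>\<close> and no boundary terms.\<close>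

lemma deriv_mean_test:
  assumes t: "t \<in> {s<..<e}"
  shows "(mean_test has_real_derivative mean_test_deriv t) (at t)"
proof -
  have "((\<lambda>t. integral (cbox 0 1) (\<lambda>\<sigma>. \<phi> (point t \<sigma>) t)) has_real_derivative
      integral (cbox 0 1) (\<lambda>\<sigma>. \<phi>x (point t \<sigma>) t * speed_at t \<sigma> + \<phi>t (point t \<sigma>) t))
      (at t within {s<..<e})"
  proof (rule leibniz_rule_field_derivative[OF _ _ _ t])
    fix r \<sigma> assume r: "r \<in> {s<..<e}"
    have "((\<lambda>r. point r \<sigma>) has_real_derivative V1 r + (V2 r - V1 r) * \<sigma>) (at r)"
      unfolding point_def by (intro DERIV_add DERIV_cmult_right DERIV_diff deriv_z deriv_y r)
    then show "((\<lambda>r. \<phi> (point r \<sigma>) r) has_real_derivative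
        \<phi>x (point r \<sigma>) r * speed_at r \<sigma> + \<phi>t (point r \<sigma>) r) (at r within {s<..<e})"
      unfolding speed_at_def
      by (rule has_field_derivative_at_within[OF deriv_along_path[OF _ times(3)[OF r]]])
  next
    fix r assume "r \<in> {s<..<e}"
    then show "(\<lambda>\<sigma>. \<phi> (point r \<sigma>) r) integrable_on cbox 0 1"
      unfolding cbox_interval by (intro integrable_continuous_interval continuous_on_slice) auto
  next
    have i: "{s<..<e} \<subseteq> {s..e}" by auto
    show "continuous_on ({s<..<e} \<times> cbox 0 1)
        (\<lambda>(t, \<sigma>). \<phi>x (point t \<sigma>) t * speed_at t \<sigma> + \<phi>t (point t \<sigma>) t)"
      using continuous_on_along[OF cont_\<phi>x i, of "cbox 0 1"]
        continuous_on_along[OF cont_\<phi>t i, of "cbox 0 1"] continuous_on_speed_at[of "cbox 0 1"]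
      unfolding split_beta by (intro continuous_intros)
  qed simp
  then show ?thesis
    using t at_within_open[of t "{s<..<e}"]
    unfolding mean_test_def[abs_def] mean_test_deriv_def cbox_interval by simp
qed

lemma mean_test_deriv_bounded: "\<exists>B. \<forall>t\<in>{s..e}. \<bar>mean_test_deriv t\<bar> \<le> B"
proof -
  obtain K where K: "K \<ge> 0" "\<And>x t. t \<in> {0..T} \<Longrightarrow> \<bar>\<phi>x x t\<bar> \<le> K" "\<And>x t. t \<in> {0..T} \<Longrightarrow> \<bar>\<phi>t x t\<bar> \<le> K"
    using bounded_derivs by metis
  have "\<bar>mean_test_deriv t\<bar> \<le> K * (3 * L) + K" if t: "t \<in> {s..e}" for t
    unfolding mean_test_deriv_def
  proof (rule abs_integral_unit_le)
    show "continuous_on {0..1} (\<lambda>\<sigma>. \<phi>x (point t \<sigma>) t * speed_at t \<sigma> + \<phi>t (point t \<sigma>) t)"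
      by (intro continuous_intros continuous_on_slice t)
    fix \<sigma> :: real assume "\<sigma> \<in> {0..1}"
    then have "\<bar>\<phi>x (point t \<sigma>) t * speed_at t \<sigma>\<bar> \<le> K * (3 * L)"
      unfolding abs_mult using K(1) by (intro mult_mono K abs_speed_at_le times(1) t) auto
    then show "\<bar>\<phi>x (point t \<sigma>) t * speed_at t \<sigma> + \<phi>t (point t \<sigma>) t\<bar> \<le> K * (3 * L) + K"
      using K(3)[OF times(1)[OF t], of "point t \<sigma>"] by linarith
  qed
  then show ?thesis by blast
qed

lemma continuous_on_excess: "continuous_on {s..e} excess"
  unfolding excess_def by (intro continuous_intros cont_z cont_y)

text \<open>The balance of one cell. As \<open>k * V\<^sub>1 - c\<close> and \<open>k * V\<^sub>2 - c\<close> are the end values of the function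
  \<open>k * speed_at t \<sigma> - c\<close>, the boundary flux is the integral over \<open>\<sigma>\<close> of the derivative of
  \<open>(k * speed_at t \<sigma> - c) * \<phi> (point t \<sigma>) t\<close>; the rest is linear algebra. The bracket is the formal
  time derivative of \<open>\<bar>excess t\<bar> * mean_test t\<close>, because the excess has derivative
  \<open>- k * (V2 t - V1 t)\<close>.\<close>

lemma cell_integral_eq:
  assumes t: "t \<in> {s..e}"
  shows "cell_integral t = (sgn (excess t) * (- k * (V2 t - V1 t)) * mean_test t +
      \<bar>excess t\<bar> * mean_test_deriv t) + boundary_flux t"
proof -
  let ?g = "y t - z t" and ?G = "V2 t - V1 t"
  let ?i = "\<lambda>h. integral {0..1} (h :: real \<Rightarrow> real)"
  let ?I0 = "?i (\<lambda>\<sigma>. \<phi> (point t \<sigma>) t)" and ?I1 = "?i (\<lambda>\<sigma>. \<phi>x (point t \<sigma>) t)"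
  let ?It = "?i (\<lambda>\<sigma>. \<phi>t (point t \<sigma>) t)" and ?IA = "?i (\<lambda>\<sigma>. \<phi>x (point t \<sigma>) t * speed_at t \<sigma>)"
  note cs = continuous_on_slice[OF t]
  have int: "(\<lambda>\<sigma>. \<phi> (point t \<sigma>) t) integrable_on {0..1}" "(\<lambda>\<sigma>. \<phi>x (point t \<sigma>) t) integrable_on {0..1}"
    "(\<lambda>\<sigma>. \<phi>t (point t \<sigma>) t) integrable_on {0..1}"
    "(\<lambda>\<sigma>. \<phi>x (point t \<sigma>) t * speed_at t \<sigma>) integrable_on {0..1}"
    by (intro integrable_continuous_interval continuous_intros cs)+
  have A: "?i (\<lambda>\<sigma>. (m * speed_at t \<sigma> - c * ?g) * \<phi>x (point t \<sigma>) t) = m * ?IA - c * ?g * ?I1"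
  proof -
    have "(\<lambda>\<sigma>. (m * speed_at t \<sigma> - c * ?g) * \<phi>x (point t \<sigma>) t) =
      (\<lambda>\<sigma>. m * (\<phi>x (point t \<sigma>) t * speed_at t \<sigma>) - c * ?g * \<phi>x (point t \<sigma>) t)"
      by (simp add: fun_eq_iff algebra_simps)
    then show ?thesis
      using Henstock_Kurzweil_Integration.integral_diff[OF integrable_on_cmult_left[OF int(4), of m]
          integrable_on_cmult_left[OF int(2), of "c * ?g"]] by simp
  qed
  have B: "mean_test_deriv t = ?IA + ?It"
    unfolding mean_test_deriv_def
    by (rule Henstock_Kurzweil_Integration.integral_add[OF int(4,3)])
  have C: "(k * V2 t - c) * \<phi> (y t) t - (k * V1 t - c) * \<phi> (z t) t =
      k * ?G * ?I0 + (k * ?g * ?IA - c * ?g * ?I1)"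
  proof -
    \<comment> \<open>The flux relative to the moving point, whose end values make up the boundary flux.\<close>
    let ?F = "\<lambda>\<sigma>. (k * speed_at t \<sigma> - c) * \<phi> (point t \<sigma>) t"
    let ?f = "\<lambda>\<sigma>. k * ?G * \<phi> (point t \<sigma>) t +
      (k * ?g * (\<phi>x (point t \<sigma>) t * speed_at t \<sigma>) - c * ?g * \<phi>x (point t \<sigma>) t)"
    have "(?f has_integral ?F 1 - ?F 0) {0..1}"
    proof (rule fundamental_theorem_of_calculus)
      fix \<sigma> :: real
      have p: "(point t has_real_derivative ?g) (at \<sigma>)"
        unfolding point_def by (auto intro!: derivative_eq_intros)
      have a: "((\<lambda>\<sigma>. k * speed_at t \<sigma> - c) has_real_derivative k * ?G) (at \<sigma>)"
        unfolding speed_at_def by (auto intro!: derivative_eq_intros)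
      have "(?F has_real_derivative ?f \<sigma>) (at \<sigma>)"
        using DERIV_mult[OF a DERIV_chain2[OF deriv_x[OF times(1)[OF t]] p]]
        by (simp add: algebra_simps)
      then show "(?F has_vector_derivative ?f \<sigma>) (at \<sigma> within {0..1})"
        by (simp add: has_real_derivative_iff_has_vector_derivative has_vector_derivative_at_within)
    qed simp
    moreover have "(?f has_integral k * ?G * ?I0 + (k * ?g * ?IA - c * ?g * ?I1)) {0..1}"
      by (intro has_integral_add has_integral_diff has_integral_mult_right integrable_integral int)
    ultimately have "?F 1 - ?F 0 = k * ?G * ?I0 + (k * ?g * ?IA - c * ?g * ?I1)"
      by (rule has_integral_unique)
    then show ?thesis by (simp add: speed_at_def point_def)
  qed
  have abs: "\<bar>excess t\<bar> = sgn (excess t) * (m - k * ?g)"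
    unfolding excess_def by (simp add: abs_sgn)
  have alg: "\<sigma> * (m - k * g) * it + \<sigma> * (m * ia - c * g * i1) =
      (\<sigma> * (- k * g') * i0 + \<sigma> * (m - k * g) * (ia + it)) +
      \<sigma> * (k * g' * i0 + (k * g * ia - c * g * i1))" for \<sigma> g g' i0 i1 it ia :: real
    by (simp add: distrib_left distrib_right left_diff_distrib right_diff_distrib ac_simps)
  show ?thesis
    unfolding cell_integral_def boundary_flux_def A B C abs mean_test_def by (rule alg)
qed

lemma cell_integral_bounded: "\<exists>B. \<forall>t\<in>{s..e}. \<bar>cell_integral t\<bar> \<le> B"
proof -
  obtain K where K: "K \<ge> 0" "\<And>x t. t \<in> {0..T} \<Longrightarrow> \<bar>\<phi>x x t\<bar> \<le> K" "\<And>x t. t \<in> {0..T} \<Longrightarrow> \<bar>\<phi>t x t\<bar> \<le> K"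
    using bounded_derivs by metis
  obtain Q where Q: "\<forall>t\<in>{s..e}. \<bar>excess t\<bar> \<le> Q"
    using compact_imp_bounded[OF compact_continuous_image[OF continuous_on_excess compact_Icc]]
    unfolding bounded_iff image_iff real_norm_def by blast
  have cd: "continuous_on {s..e} (\<lambda>t. y t - z t)" by (intro continuous_intros cont_z cont_y)
  obtain D where D: "\<forall>t\<in>{s..e}. \<bar>y t - z t\<bar> \<le> D"
    using compact_imp_bounded[OF compact_continuous_image[OF cd compact_Icc]]
    unfolding bounded_iff image_iff real_norm_def by blast
  have "\<bar>cell_integral t\<bar> \<le> Q * K + (\<bar>m\<bar> * (3 * L) + \<bar>c\<bar> * D) * K" if t: "t \<in> {s..e}" for t
  proof -
    have "\<bar>integral {0..1} (\<lambda>\<sigma>. \<phi>t (point t \<sigma>) t)\<bar> \<le> K"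
      by (intro abs_integral_unit_le continuous_on_slice t K times(1))
    then have 1: "\<bar>\<bar>excess t\<bar> * integral {0..1} (\<lambda>\<sigma>. \<phi>t (point t \<sigma>) t)\<bar> \<le> Q * K"
      unfolding abs_mult abs_idempotent using Q t by (intro mult_mono) auto
    let ?J = "integral {0..1} (\<lambda>\<sigma>. (m * speed_at t \<sigma> - c * (y t - z t)) * \<phi>x (point t \<sigma>) t)"
    have "\<bar>?J\<bar> \<le> (\<bar>m\<bar> * (3 * L) + \<bar>c\<bar> * D) * K"
    proof (rule abs_integral_unit_le)
      show "continuous_on {0..1} (\<lambda>\<sigma>. (m * speed_at t \<sigma> - c * (y t - z t)) * \<phi>x (point t \<sigma>) t)"
        by (intro continuous_intros continuous_on_slice t)
      fix \<sigma> :: real assume \<sigma>: "\<sigma> \<in> {0..1}"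
      have "\<bar>m * speed_at t \<sigma>\<bar> \<le> \<bar>m\<bar> * (3 * L)"
        unfolding abs_mult by (intro mult_left_mono abs_speed_at_le \<sigma>) auto
      moreover have "\<bar>c * (y t - z t)\<bar> \<le> \<bar>c\<bar> * D"
        unfolding abs_mult using D t by (intro mult_left_mono) auto
      ultimately have "\<bar>m * speed_at t \<sigma> - c * (y t - z t)\<bar> \<le> \<bar>m\<bar> * (3 * L) + \<bar>c\<bar> * D"
        by linarith
      then show "\<bar>(m * speed_at t \<sigma> - c * (y t - z t)) * \<phi>x (point t \<sigma>) t\<bar>
          \<le> (\<bar>m\<bar> * (3 * L) + \<bar>c\<bar> * D) * K"
        unfolding abs_mult by (intro mult_mono K times(1) t) auto
    qed
    then have "\<bar>sgn (excess t) * ?J\<bar> \<le> (\<bar>m\<bar> * (3 * L) + \<bar>c\<bar> * D) * K"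
      by (rule order_trans[OF abs_sgn_mult_le])
    then show ?thesis
      unfolding cell_integral_def by (rule order_trans[OF abs_triangle_ineq add_mono[OF 1]])
  qed
  then show ?thesis by blast
qed

text \<open>Only \<open>sgn (excess t)\<close> is discontinuous in time, and it is still measurable. Boundedness up to the
  collision time is visible in the relative coordinate only.\<close>

lemma set_integrable_cell_integral: "set_integrable lborel {s<..<e} cell_integral"
proof -
  obtain B where B: "\<forall>t\<in>{s..e}. \<bar>cell_integral t\<bar> \<le> B" using cell_integral_bounded by blast
  have i: "{s<..<e} \<subseteq> {s..e}" by auto
  have c1: "continuous_on {s<..<e} excess"
    by (rule continuous_on_subset[OF continuous_on_excess i])
  have c2: "continuous_on {s<..<e} (\<lambda>t. integral {0..1} (\<lambda>\<sigma>. \<phi>t (point t \<sigma>) t))"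
    unfolding cbox_interval[symmetric]
    by (intro integral_continuous_on_param continuous_on_along cont_\<phi>t i)
  have c3: "continuous_on {s<..<e}
      (\<lambda>t. integral {0..1} (\<lambda>\<sigma>. (m * speed_at t \<sigma> - c * (y t - z t)) * \<phi>x (point t \<sigma>) t))"
    unfolding cbox_interval[symmetric]
  proof (rule integral_continuous_on_param)
    have "continuous_on ({s<..<e} \<times> cbox 0 (1::real)) (\<lambda>p. z (fst p))"
      "continuous_on ({s<..<e} \<times> cbox 0 (1::real)) (\<lambda>p. y (fst p))"
      by (auto intro!: continuous_on_compose2[OF cont_z] continuous_on_compose2[OF cont_y]
        continuous_intros)
    then show "continuous_on ({s<..<e} \<times> cbox 0 1)
        (\<lambda>(t, \<sigma>). (m * speed_at t \<sigma> - c * (y t - z t)) * \<phi>x (point t \<sigma>) t)"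
      using continuous_on_along[OF cont_\<phi>x i, of "cbox 0 1"] continuous_on_speed_at[of "cbox 0 1"]
      unfolding split_beta by (intro continuous_intros)
  qed
  have [measurable]: "excess \<in> borel_measurable (restrict_space borel {s<..<e})"
    "(\<lambda>t. integral {0..1} (\<lambda>\<sigma>. \<phi>t (point t \<sigma>) t)) \<in> borel_measurable (restrict_space borel {s<..<e})"
    "(\<lambda>t. integral {0..1} (\<lambda>\<sigma>. (m * speed_at t \<sigma> - c * (y t - z t)) * \<phi>x (point t \<sigma>) t))
       \<in> borel_measurable (restrict_space borel {s<..<e})"
    using c1 c2 c3 by (auto intro: borel_measurable_continuous_on_restrict)
  have "cell_integral \<in> borel_measurable (restrict_space borel {s<..<e})"
    unfolding cell_integral_def[abs_def] by measurable
  then have meas: "(\<lambda>t. indicator {s<..<e} t *\<^sub>R cell_integral t) \<in> borel_measurable borel"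
    by (subst (asm) borel_measurable_restrict_space_iff) auto
  have "integrable lborel (\<lambda>t. indicator {s<..<e} t *\<^sub>R B)"
    using s_less_e by (intro integrable_scaleR_left) (simp add: integrable_indicator_iff)
  then show ?thesis
    unfolding set_integrable_def
  proof (rule Bochner_Integration.integrable_bound)
    show "(\<lambda>t. indicator {s<..<e} t *\<^sub>R cell_integral t) \<in> borel_measurable lborel"
      using meas by simp
    show "AE t in lborel. norm (indicator {s<..<e} t *\<^sub>R cell_integral t) \<le> norm (indicator {s<..<e} t *\<^sub>R B)"
    proof (intro always_eventually allI)
      fix t
      show "norm (indicator {s<..<e} t *\<^sub>R cell_integral t) \<le> norm (indicator {s<..<e} t *\<^sub>R B)"
        using B[THEN bspec, of t] by (cases "t \<in> {s<..<e}") auto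
    qed
  qed
qed

lemma has_integral_cell_entropy:
  "((\<lambda>t. cell_integral t - boundary_flux t) has_integral
     (\<bar>excess e\<bar> * mean_test e - \<bar>excess s\<bar> * mean_test s)) {s..e}"
proof -
  obtain B where B: "\<forall>t\<in>{s..e}. \<bar>mean_test_deriv t\<bar> \<le> B" using mean_test_deriv_bounded by blast
  have "((\<lambda>t. sgn (excess t) * (- k * (V2 t - V1 t)) * mean_test t + \<bar>excess t\<bar> * mean_test_deriv t)
     has_integral (\<bar>excess e\<bar> * mean_test e - \<bar>excess s\<bar> * mean_test s)) {s..e}"
  proof (rule has_integral_abs_mult[where B = "max B (\<bar>k\<bar> * (2 * L))"])
    fix t assume t: "t \<in> {s<..<e}"
    show "(excess has_real_derivative - k * (V2 t - V1 t)) (at t)"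
      unfolding excess_def[abs_def]
      using DERIV_diff[OF DERIV_const DERIV_cmult[OF DERIV_diff[OF deriv_y[OF t] deriv_z[OF t]]]]
      by simp
  next
    fix t assume t: "t \<in> {s..e}"
    have "\<bar>- k * (V2 t - V1 t)\<bar> \<le> \<bar>k\<bar> * (2 * L)"
      unfolding abs_mult using V1_le[of t] V2_le[of t] by (intro mult_mono) auto
    then show "\<bar>- k * (V2 t - V1 t)\<bar> \<le> max B (\<bar>k\<bar> * (2 * L))" by simp
    show "\<bar>mean_test_deriv t\<bar> \<le> max B (\<bar>k\<bar> * (2 * L))" using B t by (simp add: le_max_iff_disj)
  qed (use s_less_e continuous_on_excess continuous_on_mean_test deriv_mean_test in auto)
  then show ?thesis
    by (rule has_integral_eq[rotated]) (simp add: cell_integral_eq)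
qed

text \<open>Back to the space coordinate: for a nonempty cell \<open>excess t\<close> is a positive multiple of
  \<open>w - k\<close>, with the length of the cell as the factor, which is also the Jacobian.\<close>

lemma cell_integral_eq_space_integral:
  assumes t: "t \<in> {s..e}" and zy: "z t < y t" and w: "w = m / (y t - z t)"
  shows "cell_integral t = (LBINT x:{z t..y t}. \<bar>w - k\<bar> * \<phi>t x t +
     (((y t - x) / (y t - z t) * V1 t + (x - z t) / (y t - z t) * V2 t) * w - c) *
        sgn (w - k) * \<phi>x x t)"
proof -
  let ?g = "y t - z t"
  have g: "?g > 0" using zy by simp
  have ex: "excess t = ?g * (w - k)" using g by (simp add: excess_def w field_simps)
  have sgn: "sgn (excess t) = sgn (w - k)" and abs: "\<bar>excess t\<bar> = ?g * \<bar>w - k\<bar>"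
    unfolding ex using g by (simp_all add: sgn_mult abs_mult)
  have "(LBINT x:{z t..y t}. \<bar>w - k\<bar> * \<phi>t x t +
     (((y t - x) / ?g * V1 t + (x - z t) / ?g * V2 t) * w - c) * sgn (w - k) * \<phi>x x t) =
     ?g * integral {0..1} (\<lambda>\<sigma>. \<bar>w - k\<bar> * \<phi>t (z t + ?g * \<sigma>) t +
     (((y t - (z t + ?g * \<sigma>)) / ?g * V1 t + (z t + ?g * \<sigma> - z t) / ?g * V2 t) * w - c) *
       sgn (w - k) * \<phi>x (z t + ?g * \<sigma>) t)"
    by (intro set_integral_Icc_rescale zy continuous_intros continuous_on_at_time times(1)[OF t])
       (use g in auto)
  also have "(\<lambda>\<sigma>. \<bar>w - k\<bar> * \<phi>t (z t + ?g * \<sigma>) t +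
     (((y t - (z t + ?g * \<sigma>)) / ?g * V1 t + (z t + ?g * \<sigma> - z t) / ?g * V2 t) * w - c) *
       sgn (w - k) * \<phi>x (z t + ?g * \<sigma>) t) =
     (\<lambda>\<sigma>. \<bar>w - k\<bar> * \<phi>t (point t \<sigma>) t +
        sgn (w - k) / ?g * ((m * speed_at t \<sigma> - c * ?g) * \<phi>x (point t \<sigma>) t))"
  proof
    fix \<sigma>
    have 1: "(y t - (z t + ?g * \<sigma>)) / ?g = 1 - \<sigma>" "(z t + ?g * \<sigma> - z t) / ?g = \<sigma>"
      using g by (auto simp: field_simps)
    have 2: "(m * speed_at t \<sigma> - c * ?g) = ?g * (speed_at t \<sigma> * w - c)"
      using g by (simp add: w field_simps)
    have 3: "sgn (w - k) / ?g * (?g * a * b) = sgn (w - k) * a * b" for a b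
      using g by simp
    show "\<bar>w - k\<bar> * \<phi>t (z t + ?g * \<sigma>) t +
     (((y t - (z t + ?g * \<sigma>)) / ?g * V1 t + (z t + ?g * \<sigma> - z t) / ?g * V2 t) * w - c) *
       sgn (w - k) * \<phi>x (z t + ?g * \<sigma>) t = \<bar>w - k\<bar> * \<phi>t (point t \<sigma>) t +
        sgn (w - k) / ?g * ((m * speed_at t \<sigma> - c * ?g) * \<phi>x (point t \<sigma>) t)"
      unfolding 1 2 3 unfolding point_def[symmetric] by (simp add: speed_at_def algebra_simps)
  qed
  also have "integral {0..1} \<dots> = \<bar>w - k\<bar> * integral {0..1} (\<lambda>\<sigma>. \<phi>t (point t \<sigma>) t) +
      sgn (w - k) / ?g * integral {0..1} (\<lambda>\<sigma>. (m * speed_at t \<sigma> - c * ?g) * \<phi>x (point t \<sigma>) t)"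
    by (intro integral_unique has_integral_add has_integral_mult_right integrable_integral
        integrable_continuous_interval continuous_intros continuous_on_slice t)
  finally show ?thesis unfolding cell_integral_def sgn abs using g by (simp add: distrib_left)
qed

lemma abs_excess_mean_test:
  assumes t: "t \<in> {s..e}" and zy: "z t < y t" and w: "w = m / (y t - z t)"
  shows "\<bar>excess t\<bar> * mean_test t = (LBINT x:{z t..y t}. \<phi> x t * \<bar>w - k\<bar>)"
proof -
  let ?g = "y t - z t"
  have g: "?g > 0" using zy by simp
  have ex: "excess t = ?g * (w - k)" using g by (simp add: excess_def w field_simps)
  have "(LBINT x:{z t..y t}. \<phi> x t * \<bar>w - k\<bar>) =
    ?g * integral {0..1} (\<lambda>\<sigma>. \<phi> (z t + ?g * \<sigma>) t * \<bar>w - k\<bar>)"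
    by (intro set_integral_Icc_rescale zy continuous_intros continuous_on_at_time times(1)[OF t])
  note rescale = this
  show ?thesis
    unfolding rescale unfolding ex abs_mult mean_test_def point_def
    using g by (simp add: mult.commute mult.left_commute)
qed

end

section \<open>Adding up the cells of one stage\<close>

lemma weakly_increasing_upto:
  fixes a :: "nat \<Rightarrow> real"
  assumes "\<And>i. i \<le> n \<Longrightarrow> a i \<le> a (Suc i)" "i \<le> j" "j \<le> Suc n"
  shows "a i \<le> a j"
  using assms(2,3)
proof (induction j rule: dec_induct)
  case (step j)
  then show ?case using assms(1)[of j] by simp
qed simp

lemma ex_cell_containing:
  fixes a :: "nat \<Rightarrow> real"
  assumes "a 0 < x" "x < a (Suc n)" "\<And>i. i \<le> n \<Longrightarrow> x \<noteq> a i"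
  shows "\<exists>i\<le>n. a i < x \<and> x < a (Suc i)"
  using assms
proof (induction n)
  case (Suc n)
  then show ?case
    by (cases "x < a (Suc n)") (use Suc in \<open>fastforce simp: le_Suc_eq\<close>)+
qed auto

text \<open>Empty cells are allowed, since particles that meet delimit them at the end of a stage. The
  common end points of the closed cells form a finite set, which does not affect the integrals.\<close>

lemma integral_eq_sum_cells:
  fixes F :: "real \<Rightarrow> real" and h :: "nat \<Rightarrow> real \<Rightarrow> real" and a :: "nat \<Rightarrow> real"
  assumes mono: "\<And>i. i \<le> n \<Longrightarrow> a i \<le> a (Suc i)"
    and F: "\<And>i x. i \<le> n \<Longrightarrow> a i < x \<Longrightarrow> x < a (Suc i) \<Longrightarrow> F x = h i x"
    and F0: "\<And>x. x < a 0 \<or> a (Suc n) < x \<Longrightarrow> F x = 0"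
    and h: "\<And>i. i \<le> n \<Longrightarrow> continuous_on {a i..a (Suc i)} (h i)"
  shows "(LBINT x. F x) = (\<Sum>i\<le>n. LBINT x:{a i..a (Suc i)}. h i x)"
proof -
  note mono' = weakly_increasing_upto[of n a, OF mono]
  have "(LBINT x. F x) = (LBINT x. \<Sum>i\<le>n. indicator {a i..a (Suc i)} x *\<^sub>R h i x)"
  proof (rule integral_discrete_difference[where X = "a ` {..Suc n}"])
    fix x assume "x \<notin> a ` {..Suc n}"
    then have ne: "x \<noteq> a i" if "i \<le> Suc n" for i using that by auto
    show "F x = (\<Sum>i\<le>n. indicator {a i..a (Suc i)} x *\<^sub>R h i x)"
    proof (cases "x < a 0 \<or> a (Suc n) < x")
      case True
      then have "x \<notin> {a i..a (Suc i)}" if "i \<le> n" for i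
        using mono'[of 0 i] mono'[of "Suc i" "Suc n"] that by auto
      then show ?thesis using F0[OF True] by simp
    next
      case False
      then have "a 0 < x" "x < a (Suc n)" using ne[of 0] ne[of "Suc n"] by auto
      then obtain i where i: "i \<le> n" "a i < x" "x < a (Suc i)"
        using ex_cell_containing[of a x n] ne by auto
      have "indicator {a j..a (Suc j)} x *\<^sub>R h j x = (if j = i then h i x else 0)" if "j \<in> {..n}" for j
        using i that mono'[of "Suc j" i] mono'[of "Suc i" j] by (cases i j rule: linorder_cases) auto
      then have "(\<Sum>j\<le>n. indicator {a j..a (Suc j)} x *\<^sub>R h j x) = (\<Sum>j\<le>n. if j = i then h i x else 0)"
        by (rule sum.cong[OF refl])
      also have "\<dots> = h i x" using i(1) by simp
      finally show ?thesis using F[OF i] by simp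
    qed
  qed auto
  also have "\<dots> = (\<Sum>i\<le>n. LBINT x. indicator {a i..a (Suc i)} x *\<^sub>R h i x)"
  proof (rule Bochner_Integration.integral_sum)
    fix i assume "i \<in> {..n}"
    then show "integrable lborel (\<lambda>x. indicator {a i..a (Suc i)} x *\<^sub>R h i x)"
      using borel_integrable_atLeastAtMost'[OF h[of i]] by (simp add: set_integrable_def)
  qed
  finally show ?thesis unfolding set_lebesgue_integral_def .
qed

lemma summation_by_parts:
  fixes S P :: "nat \<Rightarrow> real"
  shows "(\<Sum>i\<le>n. S i * (P (Suc i) - P i)) =
    S n * P (Suc n) - S 0 * P 0 + (\<Sum>i=1..n. P i * (S (i - 1) - S i))"
  by (induction n) (simp_all add: algebra_simps)

text \<open>The cells \<open>0, \<dots>, n\<close> of a stage, with end points \<open>z 0 < \<dots> < z (n + 1)\<close>. The points \<open>z 0\<close> and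
  \<open>z (n + 1)\<close> replace \<open>-\<infinity>\<close> and \<open>+\<infinity>\<close> and lie where the test function vanishes. The assumption
  \<open>entropy\<close> is the sign of the interaction at each particle, stated in terms of the excess masses.\<close>

locale particle_stage = strip_test_function +
  fixes s e :: real and n :: nat and z V :: "nat \<Rightarrow> real \<Rightarrow> real" and L :: real
    and m :: "nat \<Rightarrow> real" and k c :: real
  assumes stage_times: "0 \<le> s" "s < e" "e \<le> T"
    and cont_z: "i \<le> Suc n \<Longrightarrow> continuous_on {s..e} (z i)"
    and deriv_z: "i \<le> Suc n \<Longrightarrow> t \<in> {s<..<e} \<Longrightarrow> (z i has_real_derivative V i t) (at t)"
    and cont_V: "i \<le> Suc n \<Longrightarrow> continuous_on {s<..<e} (V i)"
    and V_le: "i \<le> Suc n \<Longrightarrow> \<bar>V i t\<bar> \<le> L"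
    and ordered: "i \<le> n \<Longrightarrow> t \<in> {s..<e} \<Longrightarrow> z i t < z (Suc i) t"
    and outside: "t \<in> {s..e} \<Longrightarrow> z 0 t \<le> - R \<and> R \<le> z (Suc n) t"
    and R_nonneg: "0 \<le> R"
    and entropy: "i \<in> {1..n} \<Longrightarrow> t \<in> {s<..<e} \<Longrightarrow>
      0 \<le> (k * V i t - c) * (sgn (m (i - 1) - k * (z i t - z (i - 1) t)) - sgn (m i - k * (z (Suc i) t - z i t)))"
begin

lemma cell:
  assumes "i \<le> n"
  shows "moving_cell T \<phi> \<phi>x \<phi>t R s e (z i) (z (Suc i)) (V i) (V (Suc i)) L"
  using assms stage_times
  by unfold_locales (auto intro: cont_z deriv_z cont_V V_le)

definition rate :: "nat \<Rightarrow> real \<Rightarrow> real" where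
  "rate i = moving_cell.cell_integral \<phi>x \<phi>t (z i) (z (Suc i)) (V i) (V (Suc i)) (m i) k c"

definition flux :: "nat \<Rightarrow> real \<Rightarrow> real" where
  "flux i = moving_cell.boundary_flux \<phi> (z i) (z (Suc i)) (V i) (V (Suc i)) (m i) k c"

text \<open>The entropy \<open>\<integral> \<phi> \<bar>w - k\<bar>\<close> of a cell, extended continuously to collapsing cells.\<close>

definition content :: "nat \<Rightarrow> real \<Rightarrow> real" where
  "content i t = \<bar>moving_cell.excess (z i) (z (Suc i)) (m i) k t\<bar> *
     moving_cell.mean_test \<phi> (z i) (z (Suc i)) t"

lemma times: "t \<in> {s..e} \<Longrightarrow> t \<in> {0..T}"
  using stage_times by auto

lemma ordered_closed:
  assumes "i \<le> n" "t \<in> {s..e}"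
  shows "z i t \<le> z (Suc i) t"
proof -
  have "closed {t \<in> {s..e}. z i t \<le> z (Suc i) t}"
    using assms(1) by (intro continuous_on_closed_Collect_le cont_z) auto
  moreover have "{s..<e} \<subseteq> {t \<in> {s..e}. z i t \<le> z (Suc i) t}"
    using ordered[OF assms(1)] by (auto intro: less_imp_le)
  ultimately have "closure {s..<e} \<subseteq> {t \<in> {s..e}. z i t \<le> z (Suc i) t}"
    by (rule closure_minimal[rotated])
  then show ?thesis using assms(2) stage_times by auto
qed

text \<open>Summation by parts moves the fluxes from the cells to the particles, where \<open>entropy\<close> gives
  their sign; at the two outer end points \<open>\<phi>\<close> vanishes.\<close>

lemma sum_flux_nonneg:
  assumes t: "t \<in> {s<..<e}"
  shows "0 \<le> (\<Sum>i\<le>n. flux i t)"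
proof -
  define S where "S i = sgn (m i - k * (z (Suc i) t - z i t))" for i
  define P where "P i = (k * V i t - c) * \<phi> (z i t) t" for i
  have t': "t \<in> {s..e}" "t \<in> {0..T}" using t times[of t] by auto
  have "(\<Sum>i\<le>n. flux i t) = (\<Sum>i\<le>n. S i * (P (Suc i) - P i))"
    by (rule sum.cong)
       (auto simp: flux_def S_def P_def moving_cell.boundary_flux_def[OF cell]
          moving_cell.excess_def[OF cell])
  also have "\<dots> = (\<Sum>i=1..n. P i * (S (i - 1) - S i))"
    using outside[OF t'(1)] R_nonneg vanish[OF t'(2)]
    unfolding summation_by_parts by (simp add: P_def)
  also have "\<dots> \<ge> 0"
  proof (rule sum_nonneg)
    fix i assume i: "i \<in> {1..n}"
    have "0 \<le> \<phi> (z i t) t * ((k * V i t - c) * (S (i - 1) - S i))"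
      using entropy[OF i t] i by (intro mult_nonneg_nonneg[OF nonneg[OF t'(2)]]) (simp add: S_def)
    then show "0 \<le> P i * (S (i - 1) - S i)" by (simp add: P_def mult_ac)
  qed
  finally show ?thesis .
qed

lemma stage_inequality:
  shows "set_integrable lborel {s<..<e} (\<lambda>t. \<Sum>i\<le>n. rate i t)"
    and "(\<Sum>i\<le>n. content i e) - (\<Sum>i\<le>n. content i s) \<le> (LBINT t:{s<..<e}. \<Sum>i\<le>n. rate i t)"
proof -
  have "set_integrable lborel {s<..<e} (rate i)" if "i \<le> n" for i
    unfolding rate_def by (rule moving_cell.set_integrable_cell_integral[OF cell[OF that]])
  then have "integrable lborel (\<lambda>t. \<Sum>i\<le>n. indicator {s<..<e} t *\<^sub>R rate i t)"
    unfolding set_integrable_def by (intro Bochner_Integration.integrable_sum) auto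
  then show int: "set_integrable lborel {s<..<e} (\<lambda>t. \<Sum>i\<le>n. rate i t)"
    by (simp only: set_integrable_def scaleR_sum_right)
  have "((\<lambda>t. \<Sum>i\<le>n. rate i t - flux i t) has_integral (\<Sum>i\<le>n. content i e - content i s)) {s..e}"
  proof (rule has_integral_sum)
    fix i assume "i \<in> {..n}"
    then show "((\<lambda>t. rate i t - flux i t) has_integral content i e - content i s) {s..e}"
      unfolding rate_def flux_def content_def
      by (intro moving_cell.has_integral_cell_entropy[OF cell]) simp
  qed simp
  then have 1: "((\<lambda>t. \<Sum>i\<le>n. rate i t - flux i t) has_integral (\<Sum>i\<le>n. content i e - content i s)) {s<..<e}"
    by (simp add: has_integral_Icc_iff_Ioo)
  have 2: "((\<lambda>t. \<Sum>i\<le>n. rate i t) has_integral (LBINT t:{s<..<e}. \<Sum>i\<le>n. rate i t)) {s<..<e}"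
    using set_borel_integral_eq_integral[OF int] by (simp add: has_integral_integral)
  have "(\<Sum>i\<le>n. content i e - content i s) \<le> (LBINT t:{s<..<e}. \<Sum>i\<le>n. rate i t)"
    by (rule has_integral_le[OF 1 2]) (simp add: sum_subtractf sum_flux_nonneg)
  then show "(\<Sum>i\<le>n. content i e) - (\<Sum>i\<le>n. content i s) \<le> (LBINT t:{s<..<e}. \<Sum>i\<le>n. rate i t)"
    by (simp add: sum_subtractf)
qed

text \<open>The velocity matters only on cells with mass: elsewhere \<open>v\<close> vanishes and so does the product
  \<open>a x * v x\<close>. This is what makes the cut-off of the outer cells legitimate, although there the
  field is not the interpolation of \<open>V\<close>.\<close>

lemma space_integral_eq_sum_rate:
  fixes v a :: "real \<Rightarrow> real"
  assumes t: "t \<in> {s<..<e}"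
    and v: "\<And>i x. i \<le> n \<Longrightarrow> z i t < x \<Longrightarrow> x < z (Suc i) t \<Longrightarrow> v x = m i / (z (Suc i) t - z i t)"
    and a: "\<And>i x. i \<le> n \<Longrightarrow> z i t < x \<Longrightarrow> x < z (Suc i) t \<Longrightarrow> m i \<noteq> 0 \<Longrightarrow>
      a x = (z (Suc i) t - x) / (z (Suc i) t - z i t) * V i t +
            (x - z i t) / (z (Suc i) t - z i t) * V (Suc i) t"
  shows "(LBINT x. \<bar>v x - k\<bar> * \<phi>t x t + (a x * v x - c) * sgn (v x - k) * \<phi>x x t) =
    (\<Sum>i\<le>n. rate i t)"
proof -
  have t': "t \<in> {s..e}" "t \<in> {0..T}" "t \<in> {s..<e}" using t times[of t] by auto
  let ?g = "\<lambda>i. z (Suc i) t - z i t"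
  let ?w = "\<lambda>i. m i / ?g i"
  let ?h = "\<lambda>i x. \<bar>?w i - k\<bar> * \<phi>t x t +
     (((z (Suc i) t - x) / ?g i * V i t + (x - z i t) / ?g i * V (Suc i) t) * ?w i - c) *
        sgn (?w i - k) * \<phi>x x t"
  have "(LBINT x. \<bar>v x - k\<bar> * \<phi>t x t + (a x * v x - c) * sgn (v x - k) * \<phi>x x t) =
    (\<Sum>i\<le>n. LBINT x:{z i t..z (Suc i) t}. ?h i x)"
  proof (rule integral_eq_sum_cells)
    fix i assume i: "i \<le> n"
    show "z i t \<le> z (Suc i) t" using ordered[OF i t'(3)] by simp
    show "continuous_on {z i t..z (Suc i) t} (?h i)"
      by (intro continuous_intros continuous_on_at_time t'(2)) (use ordered[OF i t'(3)] in auto)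
    fix x assume x: "z i t < x" "x < z (Suc i) t"
    have "a x * ?w i = ((z (Suc i) t - x) / ?g i * V i t + (x - z i t) / ?g i * V (Suc i) t) * ?w i"
      using a[OF i x] by (cases "m i = 0") simp_all
    then show "\<bar>v x - k\<bar> * \<phi>t x t + (a x * v x - c) * sgn (v x - k) * \<phi>x x t = ?h i x"
      using v[OF i x] by simp
  next
    fix x assume "x < z 0 t \<or> z (Suc n) t < x"
    then have "R \<le> \<bar>x\<bar>" using outside[OF t'(1)] by auto
    then show "\<bar>v x - k\<bar> * \<phi>t x t + (a x * v x - c) * sgn (v x - k) * \<phi>x x t = 0"
      using vanish[OF t'(2)] by simp
  qed
  also have "\<dots> = (\<Sum>i\<le>n. rate i t)"
    unfolding rate_def using ordered t'
    by (intro sum.cong refl moving_cell.cell_integral_eq_space_integral[OF cell, symmetric]) auto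
  finally show ?thesis .
qed

text \<open>A collapsed cell is not seen by the space integral, although its \<open>content\<close> may be positive.
  This gap is the entropy that is lost in a collision.\<close>

lemma space_integral_eq_sum_content:
  fixes v :: "real \<Rightarrow> real"
  assumes t: "t \<in> {s..e}"
    and v: "\<And>i x. i \<le> n \<Longrightarrow> z i t < x \<Longrightarrow> x < z (Suc i) t \<Longrightarrow> v x = m i / (z (Suc i) t - z i t)"
  shows "(LBINT x. \<phi> x t * \<bar>v x - k\<bar>) = (\<Sum>i\<le>n. if z i t < z (Suc i) t then content i t else 0)"
proof -
  let ?w = "\<lambda>i. m i / (z (Suc i) t - z i t)"
  have "(LBINT x. \<phi> x t * \<bar>v x - k\<bar>) = (\<Sum>i\<le>n. LBINT x:{z i t..z (Suc i) t}. \<phi> x t * \<bar>?w i - k\<bar>)"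
  proof (rule integral_eq_sum_cells)
    fix x assume "x < z 0 t \<or> z (Suc n) t < x"
    then have "R \<le> \<bar>x\<bar>" using outside[OF t] by auto
    then show "\<phi> x t * \<bar>v x - k\<bar> = 0"
      using vanish[OF times[OF t]] by simp
  qed (auto simp: v intro: ordered_closed t intro!: continuous_intros continuous_on_at_time times[OF t])
  also have "\<dots> = (\<Sum>i\<le>n. if z i t < z (Suc i) t then content i t else 0)"
  proof (intro sum.cong refl)
    fix i assume i: "i \<in> {..n}"
    show "(LBINT x:{z i t..z (Suc i) t}. \<phi> x t * \<bar>?w i - k\<bar>) =
        (if z i t < z (Suc i) t then content i t else 0)"
    proof (cases "z i t < z (Suc i) t")
      case True
      then show ?thesis unfolding content_def using i
        by (simp add: moving_cell.abs_excess_mean_test[OF cell t])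
    next
      case False
      then have eq: "z (Suc i) t = z i t" using ordered_closed[OF _ t, of i] i by auto
      have "set_integrable lborel {z i t..z i t} (\<lambda>x. \<phi> x t * \<bar>?w i - k\<bar>)"
        by (intro borel_integrable_atLeastAtMost' continuous_intros continuous_on_at_time times t)
      from set_borel_integral_eq_integral(2)[OF this] show ?thesis by (simp add: eq)
    qed
  qed
  finally show ?thesis .
qed

lemma content_nonneg: "i \<le> n \<Longrightarrow> t \<in> {s..e} \<Longrightarrow> 0 \<le> content i t"
  unfolding content_def using moving_cell.mean_test_nonneg[OF cell] by simp

end

section \<open>The particles that are present in a stage\<close>

context
  fixes N :: nat and J :: "nat set"
  assumes J: "J \<subseteq> {1..N}"
begin

lemma finite_indices: "finite J"
  using J finite_subset by blast

lemma idx_in: "i \<in> {1..card J} \<Longrightarrow> idx N J i \<in> J"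
  using nth_mem[of "i - 1" "sorted_list_of_set J"] finite_indices by (auto simp: idx_def)

lemma idx_strict_mono:
  assumes "i < j" "j \<le> Suc (card J)"
  shows "idx N J i < idx N J j"
proof -
  have last: "idx N J j = Suc N" if "j = Suc (card J)" using that by (simp add: idx_def)
  have le_N: "idx N J i \<le> N" if "i \<le> card J" for i
    using idx_in[of i] J that by (cases "i = 0") (auto simp: idx_def)
  have pos: "0 < idx N J j" if "j \<in> {1..card J}" using idx_in[OF that] J by auto
  have "sorted_list_of_set J ! (i - 1) < sorted_list_of_set J ! (j - 1)"
    if "i \<ge> 1" "j \<le> card J"
    using sorted_wrt_nth_less[OF sorted_list_of_set.strict_sorted_key_list_of_set, of "i - 1" "j - 1" J] that assms
    by simp
  then have "idx N J i < idx N J j" if "i \<noteq> 0" "j \<noteq> Suc (card J)"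
    using that assms by (auto simp: idx_def)
  moreover have "idx N J i < idx N J j" if "i = 0" "j \<noteq> Suc (card J)"
    using pos that assms by (auto simp: idx_def[of N J 0])
  moreover have "idx N J i < idx N J j" if "j = Suc (card J)"
    using last[OF that] le_N[of i] that assms by simp
  ultimately show ?thesis by blast
qed

lemma idx_mono: "i \<le> j \<Longrightarrow> j \<le> Suc (card J) \<Longrightarrow> idx N J i \<le> idx N J j"
  using idx_strict_mono[of i j] by (cases "i = j") auto

lemma ex_idx:
  assumes "j \<in> J"
  obtains i where "i \<in> {1..card J}" "idx N J i = j"
proof -
  have "j \<in> set (sorted_list_of_set J)" using assms finite_indices by simp
  then obtain i where "i < card J" "sorted_list_of_set J ! i = j"
    by (auto simp: in_set_conv_nth)
  then show ?thesis by (intro that[of "Suc i"]) (auto simp: idx_def)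
qed

lemma idx_last:
  assumes "N \<in> J"
  shows "idx N J (card J) = N"
proof -
  obtain i where i: "i \<in> {1..card J}" "idx N J i = N" using ex_idx[OF assms] .
  then have "N \<le> idx N J (card J)" using idx_mono[of i "card J"] by auto
  moreover have "card J \<in> {1..card J}" using i by auto
  ultimately show ?thesis using idx_in[of "card J"] J by force
qed

text \<open>The value of the profile at a point \<open>y\<close> is the density of the last particle to the left of \<open>y\<close>,
  or of the index \<open>0\<close> if there is none. In this form the rule does not mention the enumeration of
  \<open>J\<close> and so applies before and after a deletion of particles.\<close>

lemma profile_eq:
  assumes l: "l \<in> insert 0 J"
    and left: "\<And>j. j \<in> J \<Longrightarrow> j \<le> l \<Longrightarrow> x j < y"
    and right: "\<And>j. j \<in> J \<Longrightarrow> l < j \<Longrightarrow> y < x j"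
  shows "profile N J x w y = w l"
proof -
  obtain i where i: "i \<le> card J" "idx N J i = l"
  proof (cases "l = 0")
    case True then show ?thesis by (intro that[of 0]) (auto simp: idx_def)
  next
    case False
    then have "l \<in> J" using l by simp
    then obtain i where "i \<in> {1..card J}" "idx N J i = l" by (rule ex_idx)
    then show ?thesis by (intro that[of i]) auto
  qed
  have pos: "ext_pos N x j = (if j = 0 then -\<infinity> else ereal (x j))" if "j \<in> insert 0 J" for j
    using that J by (auto simp: ext_pos_def)
  have mem: "idx N J j \<in> insert 0 J" if "j \<le> card J" for j
    using idx_in[of j] that by (cases "j = 0") (auto simp: idx_def)
  let ?I = "\<lambda>j. indicator {z. ext_pos N x (idx N J j) < ereal z \<and> ereal z < ext_pos N x (idx N J (Suc j))} y :: real"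
  have "w (idx N J j) * ?I j = (if j = i then w l else 0)" if j: "j \<in> {0..card J}" for j
  proof (cases i j rule: linorder_cases)
    case equal
    have "ext_pos N x (idx N J i) < ereal y"
      using mem[OF i(1)] left[of l] i by (auto simp: pos)
    moreover have "ereal y < ext_pos N x (idx N J (Suc i))"
    proof (cases "Suc i \<le> card J")
      case True
      then have "idx N J (Suc i) \<in> J" "l < idx N J (Suc i)"
        using idx_in[of "Suc i"] idx_strict_mono[of i "Suc i"] i by auto
      then show ?thesis using right by (auto simp: pos)
    next
      case False
      then show ?thesis using i(1) by (auto simp: idx_def ext_pos_def)
    qed
    ultimately show ?thesis using equal i by simp
  next
    case less
    then have "idx N J j \<in> J" "l < idx N J j"
      using idx_in[of j] idx_strict_mono[of i j] i j by auto
    then have "\<not> ext_pos N x (idx N J j) < ereal y" using right[of "idx N J j"] by (auto simp: pos)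
    then show ?thesis using less by simp
  next
    case greater
    then have "idx N J (Suc j) \<in> J" "idx N J (Suc j) \<le> l"
      using idx_in[of "Suc j"] idx_mono[of "Suc j" i] i j by auto
    then have "\<not> ereal y < ext_pos N x (idx N J (Suc j))" using left[of "idx N J (Suc j)"] J
      by (auto simp: pos)
    then show ?thesis using greater by simp
  qed
  then have "profile N J x w y = (\<Sum>j = 0..card J. if j = i then w l else 0)"
    unfolding profile_def by (rule sum.cong[OF refl])
  then show ?thesis using i(1) by simp
qed

end

section \<open>The velocity function and the entropy condition at a particle\<close>

text \<open>At \<open>v = 0\<close> the bound is the limit of the bound for the difference quotients.\<close>

lemma abs_speed_le:
  assumes L: "L-lipschitz_on UNIV f" and f0: "f 0 = 0" and diff: "f differentiable (at 0)"
  shows "\<bar>speed f v\<bar> \<le> L"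
proof -
  have le: "\<bar>f h / h\<bar> \<le> L" if "h \<noteq> 0" for h
    using lipschitz_onD[OF L, of h 0] that f0 by (simp add: dist_real_def field_simps)
  have "(f has_real_derivative deriv f 0) (at 0)"
    using diff by (simp add: DERIV_deriv_iff_real_differentiable)
  then have lim: "((\<lambda>h. f h / h) \<longlongrightarrow> deriv f 0) (at 0)"
    using f0 by (simp add: has_field_derivative_iff)
  have "\<bar>deriv f 0\<bar> \<le> L"
    by (rule tendsto_upperbound[OF tendsto_rabs[OF lim]])
       (use le in \<open>auto simp: eventually_at intro!: exI[of _ 1]\<close>)
  then show ?thesis using le by (auto simp: speed_def)
qed

context
  fixes f :: "real \<Rightarrow> real" and L :: real
  assumes speed_le: "\<And>v. \<bar>speed f v\<bar> \<le> L"
begin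

lemma bdd_speed: "bdd_below (speed f ` S)" "bdd_above (speed f ` S)"
  using speed_le by (auto simp: abs_le_iff intro!: bdd_belowI2[of _ "- L"] bdd_aboveI2[of _ _ L])
     (metis minus_le_iff)

lemma abs_velocity_le: "\<bar>velocity f a b\<bar> \<le> L"
proof -
  have *: "- L \<le> speed f v" "speed f v \<le> L" for v using speed_le[of v] by auto
  show ?thesis
  proof (cases "a \<le> b")
    case True
    have "(INF v\<in>{a..b}. speed f v) \<le> speed f a" using True by (intro cINF_lower bdd_speed) auto
    moreover have "- L \<le> (INF v\<in>{a..b}. speed f v)" using True * by (intro cINF_greatest) auto
    ultimately show ?thesis using True *[of a] by (simp add: velocity_def)
  next
    case False
    have "speed f a \<le> (SUP v\<in>{b..a}. speed f v)" using False by (intro cSUP_upper bdd_speed) auto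
    moreover have "(SUP v\<in>{b..a}. speed f v) \<le> L" using False * by (intro cSUP_least) auto
    ultimately show ?thesis using False *[of a] by (simp add: velocity_def)
  qed
qed

text \<open>If \<open>k\<close> is not between \<open>a\<close> and \<open>b\<close>, the signs agree. If \<open>a \<le> k \<le> b\<close>, the velocity is an infimum
  over a set containing \<open>k\<close>, so both factors are nonpositive; if \<open>b \<le> k \<le> a\<close>, it is a supremum
  and both are nonnegative. For \<open>k = 0\<close> the first factor is \<open>0\<close>.\<close>

lemma velocity_entropy:
  assumes "k \<ge> 0" "f 0 = 0"
  shows "0 \<le> (k * velocity f a b - f k) * (sgn (a - k) - sgn (b - k))"
proof (cases "k = 0")
  case False
  then have k: "k > 0" and fk: "f k = k * speed f k" using assms by (auto simp: speed_def)
  have eq: "(k * velocity f a b - f k) = k * (velocity f a b - speed f k)"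
    by (simp add: fk algebra_simps)
  have "0 \<le> (velocity f a b - speed f k) * (sgn (a - k) - sgn (b - k))"
  proof (cases "a \<le> b")
    case True
    show ?thesis
    proof (cases "a \<le> k \<and> k \<le> b")
      case True
      then have "velocity f a b \<le> speed f k"
        unfolding velocity_def by (auto intro!: cINF_lower bdd_speed)
      moreover have "sgn (a - k) \<le> sgn (b - k)" using True by (auto simp: sgn_if)
      ultimately show ?thesis by (intro mult_nonpos_nonpos) auto
    next
      case False
      then show ?thesis using True by (auto simp: sgn_if)
    qed
  next
    case ba: False
    show ?thesis
    proof (cases "b \<le> k \<and> k \<le> a")
      case True
      then have "speed f k \<le> velocity f a b"
        unfolding velocity_def using ba by (auto intro!: cSUP_upper bdd_speed)
      moreover have "sgn (b - k) \<le> sgn (a - k)" using True by (auto simp: sgn_if)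
      ultimately show ?thesis by (intro mult_nonneg_nonneg) auto
    next
      case False
      then show ?thesis using ba by (auto simp: sgn_if)
    qed
  qed
  then show ?thesis unfolding eq using k by (simp add: mult.assoc)
qed (use assms in simp)

end

section \<open>One stage of the scheme as a family of moving cells\<close>

text \<open>A stage in the state in which the scheme enters it: the remaining particles are separated at the
  time \<open>s\<close>. The bound \<open>B\<close> on the positions gives the cut-off points of the outer cells.\<close>

locale scheme_run_stage =
  fixes f :: "real \<Rightarrow> real" and T :: real and N :: nat and X W :: "nat \<Rightarrow> real \<Rightarrow> real"
    and s e :: real and J J' :: "nat set" and L B :: real
  assumes stage: "scheme_stage f T N X W s e J J'"
    and J: "J \<subseteq> {1..N}" and N_in: "N \<in> J" and s_nonneg: "0 \<le> s"
    and start_sep: "strict_mono_on J (\<lambda>i. X i s)"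
    and W_ends: "t \<in> {0..T} \<Longrightarrow> W 0 t = 0 \<and> W N t = 0"
    and X_bound: "i \<in> J \<Longrightarrow> t \<in> {s..e} \<Longrightarrow> \<bar>X i t\<bar> < B"
    and speed_le: "\<bar>speed f v\<bar> \<le> L"
begin

abbreviation (input) n where "n \<equiv> card J"
abbreviation (input) \<pi> where "\<pi> \<equiv> idx N J"

text \<open>The positions of the remaining particles in increasing order, with \<open>-B\<close> and \<open>B\<close> in place of
  \<open>-\<infinity>\<close> and \<open>+\<infinity>\<close>.\<close>

definition pos :: "nat \<Rightarrow> real \<Rightarrow> real" where
  "pos i t = (if i = 0 then - B else if i \<le> n then X (\<pi> i) t else B)"

definition vel :: "nat \<Rightarrow> real \<Rightarrow> real" where
  "vel i t = (if i \<in> {1..n} then velocity f (W (\<pi> (i - 1)) t) (W (\<pi> i) t) else 0)"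

definition mass :: "nat \<Rightarrow> real" where
  "mass i = (if i \<in> {1..<n} then (X (\<pi> (Suc i)) s - X (\<pi> i) s) * W (\<pi> i) s else 0)"

lemma stage_times: "s < e" "e \<le> T"
  using stage unfolding scheme_stage_def Let_def by blast+

lemma X_cont: "i \<in> {1..n} \<Longrightarrow> continuous_on {s..e} (X (\<pi> i))"
  and X_C1: "i \<in> {1..n} \<Longrightarrow> X (\<pi> i) C1_differentiable_on {s<..<e}"
  and X_deriv: "i \<in> {1..n} \<Longrightarrow> t \<in> {s<..<e} \<Longrightarrow>
    (X (\<pi> i) has_real_derivative velocity f (W (\<pi> (i - 1)) t) (W (\<pi> i) t)) (at t)"
  and X_less: "i \<in> {1..<n} \<Longrightarrow> t \<in> {s<..<e} \<Longrightarrow> X (\<pi> i) t < X (\<pi> (Suc i)) t"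
  and W_eq: "i \<in> {1..<n} \<Longrightarrow> t \<in> {s<..<e} \<Longrightarrow>
    W (\<pi> i) t = (X (\<pi> (Suc i)) s - X (\<pi> i) s) / (X (\<pi> (Suc i)) t - X (\<pi> i) t) * W (\<pi> i) s"
  and J'_eq: "J' = {\<pi> i | i. i \<in> {1..n} \<and>
      ext_pos N (\<lambda>k. X k e) (\<pi> i) \<noteq> ext_pos N (\<lambda>k. X k e) (\<pi> (i + 1))}"
  and W_lim: "j \<in> J' \<Longrightarrow> (W j \<longlongrightarrow> W j e) (at_left e)"
  using stage unfolding scheme_stage_def Let_def Suc_eq_plus1 by blast+

lemma n_pos: "0 < n"
  using N_in finite_indices[OF J] by (auto simp: card_gt_0_iff)

lemma pi_0: "\<pi> 0 = 0" and pi_n: "\<pi> n = N" and pi_in: "i \<in> {1..n} \<Longrightarrow> \<pi> i \<in> J"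
  using idx_last[OF J N_in] idx_in[OF J] by (auto simp: idx_def)

lemma pos_less:
  assumes "i \<le> n" "t \<in> {s..<e}"
  shows "pos i t < pos (Suc i) t"
proof -
  have t: "t \<in> {s..e}" using assms by auto
  have bd: "\<bar>X (\<pi> i) t\<bar> < B" if "i \<in> {1..n}" for i using X_bound[OF pi_in[OF that] t] .
  have "X (\<pi> i) t < X (\<pi> (Suc i)) t" if i: "i \<in> {1..<n}"
  proof (cases "t = s")
    case True
    then show ?thesis
      using strict_mono_onD[OF start_sep pi_in pi_in idx_strict_mono[OF J, of i "Suc i"]] i by auto
  next
    case False
    then show ?thesis using X_less[OF i] assms(2) by auto
  qed
  note inner = this
  consider "i = 0" | "i = n" | "i \<in> {1..<n}" using assms(1) by fastforce
  then show ?thesis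
  proof cases
    case 1
    have "pos 0 t = - B" "pos (Suc 0) t = X (\<pi> 1) t" using n_pos by (simp_all add: pos_def)
    moreover have "- B < X (\<pi> 1) t" using bd[of 1] n_pos by (simp add: abs_less_iff)
    ultimately show ?thesis unfolding 1 by simp
  next
    case 2
    have "pos n t = X (\<pi> n) t" "pos (Suc n) t = B" using n_pos by (simp_all add: pos_def)
    moreover have "X (\<pi> n) t < B" using bd[of n] n_pos by (simp add: abs_less_iff)
    ultimately show ?thesis unfolding 2 by simp
  next
    case 3
    then have "pos i t = X (\<pi> i) t" "pos (Suc i) t = X (\<pi> (Suc i)) t" by (simp_all add: pos_def)
    then show ?thesis using inner[OF 3] by simp
  qed
qed

lemma pos_inner: "i \<in> {1..n} \<Longrightarrow> pos i = X (\<pi> i)"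
  by (auto simp: pos_def fun_eq_iff)

lemma pos_outer: "i \<notin> {1..n} \<Longrightarrow> pos i = (\<lambda>_. if i = 0 then - B else B)"
  by (auto simp: pos_def fun_eq_iff)

lemma continuous_on_pos: "continuous_on {s..e} (pos i)"
proof (cases "i \<in> {1..n}")
  case True
  then show ?thesis using X_cont[OF True] by (simp only: pos_inner)
next
  case False
  then show ?thesis by (simp add: pos_outer)
qed

lemma deriv_pos:
  assumes "t \<in> {s<..<e}"
  shows "(pos i has_real_derivative vel i t) (at t)"
proof (cases "i \<in> {1..n}")
  case True
  then show ?thesis using X_deriv[OF True assms] unfolding vel_def by (simp only: pos_inner if_True)
next
  case False
  then have "vel i t = 0" by (simp only: vel_def if_False)
  then show ?thesis unfolding pos_outer[OF False] by simp
qed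

text \<open>The velocity inherits its continuity in time from the \<open>C\<^sup>1\<close> regularity of the paths.\<close>

lemma continuous_on_vel: "continuous_on {s<..<e} (vel i)"
proof (cases "i \<in> {1..n}")
  case True
  obtain D where D: "\<And>t. t \<in> {s<..<e} \<Longrightarrow> (X (\<pi> i) has_vector_derivative D t) (at t)"
    "continuous_on {s<..<e} D"
    using X_C1[OF True] unfolding C1_differentiable_on_def by blast
  have "vel i t = D t" if "t \<in> {s<..<e}" for t
    using vector_derivative_unique_at[OF _ D(1)[OF that]] X_deriv[OF True that] True
    by (simp add: vel_def has_real_derivative_iff_has_vector_derivative)
  then show ?thesis using D(2) continuous_on_cong[of "{s<..<e}" "{s<..<e}" "vel i" D] by blast
next
  case False
  then have "vel i = (\<lambda>_. 0)" unfolding vel_def by (simp only: if_False)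
  then show ?thesis by simp
qed

lemma L_nonneg: "0 \<le> L"
  using speed_le[of 0] by linarith

lemma abs_vel_le: "\<bar>vel i t\<bar> \<le> L"
  unfolding vel_def using abs_velocity_le[OF speed_le] L_nonneg by auto

lemma density_eq:
  assumes i: "i \<le> n" and t: "t \<in> {s..<e}"
  shows "W (\<pi> i) t = mass i / (pos (Suc i) t - pos i t)"
proof (cases "i \<in> {1..<n}")
  case True
  show ?thesis
  proof (cases "t = s")
    case True
    then show ?thesis using pos_less[OF i t] \<open>i \<in> {1..<n}\<close> by (simp add: mass_def pos_def)
  next
    case False
    then have "t \<in> {s<..<e}" using t by auto
    from W_eq[OF True this] True show ?thesis by (simp add: mass_def pos_def)
  qed
next
  case False
  then have "i = 0 \<or> i = n" using i by auto
  moreover have "t \<in> {0..T}" using t s_nonneg stage_times by auto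
  ultimately have "W (\<pi> i) t = 0" using W_ends[of t] pi_0 pi_n by auto
  then show ?thesis using False by (simp only: mass_def if_False div_0)
qed

lemma survives:
  assumes "i \<in> {1..n}" "pos i e < pos (Suc i) e"
  shows "\<pi> i \<in> J'"
proof -
  have "\<pi> i \<in> {1..N}" using pi_in[OF assms(1)] J by auto
  then have 1: "ext_pos N (\<lambda>k. X k e) (\<pi> i) = ereal (pos i e)"
    using assms(1) by (auto simp: ext_pos_def pos_def)
  have "ext_pos N (\<lambda>k. X k e) (\<pi> (i + 1)) \<noteq> ereal (pos i e)"
  proof (cases "i = n")
    case True
    then show ?thesis by (simp add: ext_pos_def idx_def)
  next
    case False
    then have i: "Suc i \<in> {1..n}" using assms(1) by auto
    then have "\<pi> (Suc i) \<in> {1..N}" using pi_in[OF i] J by auto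
    then show ?thesis using assms(2) i by (auto simp: ext_pos_def pos_def)
  qed
  then show ?thesis unfolding J'_eq using assms(1) 1 by auto
qed

text \<open>For a surviving cell the prescribed value at the end of the stage is the left limit of its
  density, and its length stays positive.\<close>

lemma density_eq_end:
  assumes i: "i \<le> n" and less: "pos i e < pos (Suc i) e"
  shows "W (\<pi> i) e = mass i / (pos (Suc i) e - pos i e)"
proof (cases "i \<in> {1..<n}")
  case True
  then have "\<pi> i \<in> J'" using survives[OF _ less] by auto
  note lim = W_lim[OF this]
  have ev: "eventually (\<lambda>t. t \<in> {s..<e}) (at_left e)"
    using stage_times(1) by (auto simp: eventually_at_left intro!: exI[of _ s])
  have "(pos i \<longlongrightarrow> pos i e) (at_left e)" for i
  proof -
    have "(pos i \<longlongrightarrow> pos i e) (at e within {s..e})"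
      using continuous_on_pos[of i] stage_times(1) by (auto simp: continuous_on_def)
    then show ?thesis using stage_times(1) by (simp add: at_within_Icc_at_left)
  qed
  then have "((\<lambda>t. mass i / (pos (Suc i) t - pos i t)) \<longlongrightarrow> mass i / (pos (Suc i) e - pos i e)) (at_left e)"
    using less by (intro tendsto_intros) auto
  then have "(W (\<pi> i) \<longlongrightarrow> mass i / (pos (Suc i) e - pos i e)) (at_left e)"
    by (rule Lim_transform_eventually) (use ev in eventually_elim, simp add: density_eq[OF i])
  then show ?thesis using tendsto_unique[OF _ lim] by simp
next
  case False
  then have "i = 0 \<or> i = n" using i by auto
  moreover have "e \<in> {0..T}" using s_nonneg stage_times by auto
  ultimately have "W (\<pi> i) e = 0" using W_ends[of e] pi_0 pi_n by auto
  then show ?thesis using False by (simp only: mass_def if_False div_0)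
qed

lemma pos_mono:
  assumes "t \<in> {s..e}" "i \<le> j" "j \<le> Suc n"
  shows "pos i t \<le> pos j t"
proof (rule weakly_increasing_upto[OF _ assms(2,3)])
  fix i assume i: "i \<le> n"
  have "closed {t \<in> {s..e}. pos i t \<le> pos (Suc i) t}"
    by (intro continuous_on_closed_Collect_le continuous_on_pos) auto
  moreover have "{s..<e} \<subseteq> {t \<in> {s..e}. pos i t \<le> pos (Suc i) t}"
    using pos_less[OF i] by (auto intro: less_imp_le)
  ultimately have "closure {s..<e} \<subseteq> {t \<in> {s..e}. pos i t \<le> pos (Suc i) t}"
    by (rule closure_minimal[rotated])
  then show "pos i t \<le> pos (Suc i) t" using assms(1) stage_times by auto
qed

text \<open>The index set \<open>K\<close> is \<open>J\<close> during the stage, and \<open>J'\<close> at its end, when the remaining nonempty cells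
  of \<open>J\<close> are the cells of \<open>J'\<close>.\<close>

lemma profile_on_cell:
  assumes t: "t \<in> {s..e}" and i: "i \<le> n" and x: "pos i t < x" "x < pos (Suc i) t"
    and K: "K \<subseteq> J" "\<pi> i \<in> insert 0 K"
  shows "profile N K (\<lambda>i. X i t) (\<lambda>i. W i t) x = W (\<pi> i) t"
proof (rule profile_eq)
  show "K \<subseteq> {1..N}" using K J by auto
  fix j assume j: "j \<in> K"
  then obtain i' where i': "i' \<in> {1..n}" "\<pi> i' = j" using ex_idx[OF J] K(1) by blast
  then have X: "X j t = pos i' t" by (auto simp: pos_def)
  show "X j t < x" if "j \<le> \<pi> i"
  proof -
    have "i' \<le> i" using idx_strict_mono[OF J, of i i'] that i' by (cases "i < i'") auto
    then show ?thesis using pos_mono[OF t, of i' i] i x by (simp add: X)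
  qed
  show "x < X j t" if "\<pi> i < j"
  proof -
    have "Suc i \<le> i'" using idx_mono[OF J, of i' i] that i' i by (cases "i < i'") auto
    then show ?thesis using pos_mono[OF t, of "Suc i" i'] i' x by (simp add: X)
  qed
qed (fact K(2))

text \<open>In the interior of a cell the least cell containing \<open>x\<close> is that cell.\<close>

lemma velocity_on_cell:
  assumes t: "t \<in> {s..e}" and i: "i \<in> {1..<n}" and x: "pos i t < x" "x < pos (Suc i) t"
  shows "interpolated_velocity f N J (\<lambda>i. X i t) (\<lambda>i. W i t) x =
    (pos (Suc i) t - x) / (pos (Suc i) t - pos i t) * vel i t +
    (x - pos i t) / (pos (Suc i) t - pos i t) * vel (Suc i) t"
proof -
  have X: "X (\<pi> j) t = pos j t" if "j \<in> {1..n}" for j using that by (simp add: pos_def)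
  have 1: "\<not> x \<le> X (\<pi> 1) t" using pos_mono[OF t, of 1 i] i x by (simp add: X)
  have 2: "\<not> X (\<pi> n) t \<le> x" using pos_mono[OF t, of "Suc i" n] i x by (simp add: X)
  have least: "(LEAST j. 1 \<le> j \<and> j \<le> n - 1 \<and> x \<in> {X (\<pi> j) t..X (\<pi> (j + 1)) t}) = i"
  proof (rule Least_equality)
    show "1 \<le> i \<and> i \<le> n - 1 \<and> x \<in> {X (\<pi> i) t..X (\<pi> (i + 1)) t}"
      using i x by (auto simp: X[of i] X[of "Suc i"])
    fix j assume j: "1 \<le> j \<and> j \<le> n - 1 \<and> x \<in> {X (\<pi> j) t..X (\<pi> (j + 1)) t}"
    show "i \<le> j"
    proof (rule ccontr)
      assume "\<not> i \<le> j"
      then have "pos (Suc j) t \<le> pos i t" using pos_mono[OF t, of "Suc j" i] i by auto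
      moreover have "Suc j \<in> {1..n}" unfolding atLeastAtMost_iff using j n_pos by linarith
      ultimately show False using j x X[of "Suc j"] by auto
    qed
  qed
  show ?thesis
    unfolding interpolated_velocity_def Let_def if_not_P[OF 1] if_not_P[OF 2] least
    using i by (simp add: X vel_def)
qed

text \<open>After the deletion the particles are again separated: a surviving particle is strictly to the
  left of its former right neighbour, hence of all later survivors.\<close>

lemma survivors: "J' \<subseteq> J" "N \<in> J'" "strict_mono_on J' (\<lambda>i. X i e)"
proof -
  show J'J: "J' \<subseteq> J" unfolding J'_eq using pi_in by auto
  have "pos n e < pos (Suc n) e"
    using X_bound[OF N_in, of e] stage_times n_pos pi_n by (auto simp: pos_def)
  then show "N \<in> J'" using survives[of n] n_pos pi_n by auto
  show "strict_mono_on J' (\<lambda>i. X i e)"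
  proof (rule strict_mono_onI)
    fix a b assume ab: "a \<in> J'" "b \<in> J'" "a < b"
    obtain i where i: "i \<in> {1..n}" "\<pi> i = a"
      and ne: "ext_pos N (\<lambda>k. X k e) (\<pi> i) \<noteq> ext_pos N (\<lambda>k. X k e) (\<pi> (i + 1))"
      using ab(1) unfolding J'_eq by auto
    obtain j where j: "j \<in> {1..n}" "\<pi> j = b" using ab(2) J'J ex_idx[OF J] by blast
    have ij: "i < j" using idx_mono[OF J, of j i] i j ab(3) by (cases "i < j") auto
    have "\<pi> i \<in> {1..N}" "\<pi> (Suc i) \<in> {1..N}" using pi_in[of i] pi_in[of "Suc i"] i j ij J by auto
    then have "pos i e \<noteq> pos (Suc i) e"
      using ne i j ij by (auto simp: ext_pos_def pos_def)
    moreover have "pos i e \<le> pos (Suc i) e" "pos (Suc i) e \<le> pos j e"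
      using pos_mono[of e] stage_times i j ij by auto
    ultimately show "X a e < X b e" using i j ij by (auto simp: pos_def)
  qed
qed

end

section \<open>The entropy inequality for the scheme\<close>

text \<open>The derivatives vanish off a bounded set as well: a point beyond distance \<open>R\<close> has a
  neighbourhood in space on which \<open>\<phi>\<close> is \<open>0\<close> at all times.\<close>

lemma test_function_strip:
  assumes T: "T > 0" and \<phi>: "test_function T \<phi>" and nonneg: "\<forall>x. \<forall>t\<in>{0..T}. \<phi> x t \<ge> 0"
  obtains \<phi>x \<phi>t R where "strip_test_function T \<phi> \<phi>x \<phi>t R" "R \<ge> 0"
proof -
  obtain D :: "nat \<Rightarrow> nat \<Rightarrow> real \<Rightarrow> real \<Rightarrow> real" where D:
    "\<forall>x. \<forall>t\<in>{0..T}. D 0 0 x t = \<phi> x t"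
    "\<forall>m n. continuous_on (UNIV \<times> {0..T}) (\<lambda>(x, t). D m n x t)"
    "\<forall>m n x. \<forall>t\<in>{0..T}.
       ((\<lambda>y. D m n y t) has_real_derivative D (Suc m) n x t) (at x) \<and>
       ((\<lambda>s. D m n x s) has_real_derivative D m (Suc n) x t) (at t within {0..T})"
    using \<phi> unfolding test_function_def by (elim conjE exE) (rule that)
  have D0: "\<And>x t. t \<in> {0..T} \<Longrightarrow> D 0 0 x t = \<phi> x t"
    and cont: "\<And>m n. continuous_on (UNIV \<times> {0..T}) (\<lambda>(x, t). D m n x t)"
    and Dx: "\<And>m n x t. t \<in> {0..T} \<Longrightarrow> ((\<lambda>y. D m n y t) has_real_derivative D (Suc m) n x t) (at x)"
    and Dt: "\<And>m n x t. t \<in> {0..T} \<Longrightarrow>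
      ((\<lambda>s. D m n x s) has_real_derivative D m (Suc n) x t) (at t within {0..T})"
    using D by blast+
  have "bounded {(x, t). t \<in> {0..T} \<and> \<phi> x t \<noteq> 0}"
    using \<phi> unfolding test_function_def by (meson bounded_subset closure_subset compact_imp_bounded)
  then obtain b where b: "\<And>p. p \<in> {(x, t). t \<in> {0..T} \<and> \<phi> x t \<noteq> 0} \<Longrightarrow> norm p \<le> b"
    unfolding bounded_iff by blast
  have zero: "\<phi> x t = 0" if "t \<in> {0..T}" "b < \<bar>x\<bar>" for x t
  proof (rule ccontr)
    assume "\<phi> x t \<noteq> 0"
    then have "norm (x, t) \<le> b" using b[of "(x, t)"] that by simp
    then show False using norm_fst_le[of x t] that by simp
  qed
  \<comment> \<open>Strictly larger than the bound on the support, so that every point beyond it has a neighbourhood where the test function is zero.\<close>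
  define R where "R = max b 0 + 1"
  have dx: "((\<lambda>y. \<phi> y t) has_real_derivative D 1 0 x t) (at x)" if "t \<in> {0..T}" for x t
    using Dx[OF that, of 0 0 x] D0[OF that] by simp
  have dt: "((\<lambda>s. \<phi> x s) has_real_derivative D 0 1 x t) (at t within {0..T})" if t: "t \<in> {0..T}" for x t
    using has_field_derivative_transform_within[OF Dt[OF t, of 0 0 x] zero_less_one t] D0 by simp
  have x0: "D 1 0 x t = 0" if t: "t \<in> {0..T}" and x: "R \<le> \<bar>x\<bar>" for x t
  proof -
    have "open {y :: real. b < \<bar>y\<bar>}" by (intro open_Collect_less continuous_intros)
    moreover have "x \<in> {y. b < \<bar>y\<bar>}" using x by (simp add: R_def)
    ultimately have "((\<lambda>y. \<phi> y t) has_real_derivative 0) (at x)"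
      using has_field_derivative_transform_within_open[of "\<lambda>_. 0" 0 x "{y. b < \<bar>y\<bar>}" "\<lambda>y. \<phi> y t"] zero[OF t]
      by simp
    then show ?thesis using DERIV_unique dx[OF t] by blast
  qed
  have t0: "D 0 1 x t = 0" if t: "t \<in> {0..T}" and x: "R \<le> \<bar>x\<bar>" for x t
  proof -
    have "((\<lambda>s. \<phi> x s) has_real_derivative 0) (at t within {0..T})"
      by (rule has_field_derivative_transform_within[OF DERIV_const[of 0] zero_less_one t])
         (use zero x in \<open>simp add: R_def\<close>)
    from vector_derivative_unique_within_closed_interval[OF T, unfolded cbox_interval, OF t
        dt[OF t, unfolded has_real_derivative_iff_has_vector_derivative]
        this[unfolded has_real_derivative_iff_has_vector_derivative]]
    show ?thesis .
  qed
  have "continuous_on (UNIV \<times> {0..T}) (\<lambda>(x, t). \<phi> x t)"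
    using cont[of 0 0] by (rule continuous_on_eq) (auto simp: D0)
  note cont_\<phi> = this
  have "strip_test_function T \<phi> (D 1 0) (D 0 1) R"
  proof
    show "\<phi> x t = 0 \<and> D 1 0 x t = 0 \<and> D 0 1 x t = 0" if "t \<in> {0..T}" "R \<le> \<bar>x\<bar>" for x t
      using zero[OF that(1), of x] x0[OF that] t0[OF that] that(2) by (simp add: R_def)
    show "0 \<le> \<phi> x t" if "t \<in> {0..T}" for x t using nonneg that by blast
  qed (fact cont_\<phi> cont dx dt)+
  then show ?thesis by (rule that) (simp add: R_def)
qed

text \<open>Separated inside the stage, the cells have densities \<open>W\<close> with mass over length, so the sign of
  the excess mass is the sign of \<open>W - k\<close> and the interaction at each particle is controlled by
  \<open>velocity_entropy\<close>. At the end of the stage the entropy of the survivors is at most the limit of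
  the entropy, as the collapsed cells contribute nonnegatively.\<close>

lemma (in strip_test_function) stage_entropy_inequality:
  fixes s e :: real and f :: "real \<Rightarrow> real" and N :: nat and X W :: "nat \<Rightarrow> real \<Rightarrow> real"
    and k :: real and J J' :: "nat set"
  defines "v K t \<equiv> profile N K (\<lambda>i. X i t) (\<lambda>i. W i t)"
  defines "a t \<equiv> interpolated_velocity f N J (\<lambda>i. X i t) (\<lambda>i. W i t)"
  defines "F t \<equiv> LBINT x. \<bar>v J t x - k\<bar> * \<phi>t x t + (a t x * v J t x - f k) * sgn (v J t x - k) * \<phi>x x t"
  assumes stage: "scheme_run_stage f T N X W s e J J' L B"
    and R: "0 \<le> R" "R \<le> B" and k: "0 \<le> k" and f0: "f 0 = 0"
  shows "set_integrable lborel {s<..<e} F"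
    and "(LBINT x. \<phi> x e * \<bar>v J' e x - k\<bar>) - (LBINT x. \<phi> x s * \<bar>v J s x - k\<bar>) \<le> (LBINT t:{s<..<e}. F t)"
proof -
  interpret st: scheme_run_stage f T N X W s e J J' L B by (fact stage)
  have se: "s \<in> {s..e}" "e \<in> {s..e}" "s \<in> {s..<e}" using st.stage_times by auto
  have gap: "0 < st.pos (Suc i) t - st.pos i t" if "i \<le> card J" "t \<in> {s..<e}" for i t
    using st.pos_less[OF that] by simp
  \<comment> \<open>Cells are nonempty before the end of the stage, so the excess mass has the sign of the excess density.\<close>
  have excess: "st.mass i - k * (st.pos (Suc i) t - st.pos i t) =
      (W (idx N J i) t - k) * (st.pos (Suc i) t - st.pos i t)"
    if "i \<le> card J" "t \<in> {s..<e}" for i t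
    using st.density_eq[OF that] gap[OF that] by (simp add: left_diff_distrib)
  interpret ps: particle_stage T \<phi> \<phi>x \<phi>t R s e "card J" st.pos st.vel L st.mass k "f k"
  proof unfold_locales
    show "0 \<le> s" "s < e" "e \<le> T" "0 \<le> R" using st.s_nonneg st.stage_times R by auto
    show "continuous_on {s..e} (st.pos i)" "continuous_on {s<..<e} (st.vel i)" "\<bar>st.vel i t\<bar> \<le> L" for i t
      by (fact st.continuous_on_pos st.continuous_on_vel st.abs_vel_le)+
    show "(st.pos i has_real_derivative st.vel i t) (at t)" if "t \<in> {s<..<e}" for i t
      using st.deriv_pos[OF that] .
    show "st.pos i t < st.pos (Suc i) t" if "i \<le> card J" "t \<in> {s..<e}" for i t
      using st.pos_less[OF that] .
    show "st.pos 0 t \<le> - R \<and> R \<le> st.pos (Suc (card J)) t" for t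
      using R by (simp add: st.pos_def)
    fix i t assume i: "i \<in> {1..card J}" and t: "t \<in> {s<..<e}"
    then have i': "i \<le> card J" "i - 1 \<le> card J" "Suc (i - 1) = i" and t': "t \<in> {s..<e}" by auto
    have "sgn (st.mass (i - 1) - k * (st.pos i t - st.pos (i - 1) t)) = sgn (W (idx N J (i - 1)) t - k)"
      using excess[OF i'(2) t'] gap[OF i'(2) t'] unfolding i'(3) by (simp add: sgn_mult)
    moreover have "sgn (st.mass i - k * (st.pos (Suc i) t - st.pos i t)) = sgn (W (idx N J i) t - k)"
      using excess[OF i'(1) t'] gap[OF i'(1) t'] by (simp add: sgn_mult)
    moreover have "st.vel i t = velocity f (W (idx N J (i - 1)) t) (W (idx N J i) t)"
      unfolding st.vel_def using i by (simp only: if_True)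
    ultimately show "0 \<le> (k * st.vel i t - f k) *
        (sgn (st.mass (i - 1) - k * (st.pos i t - st.pos (i - 1) t)) -
         sgn (st.mass i - k * (st.pos (Suc i) t - st.pos i t)))"
      using velocity_entropy[of f L k, OF st.speed_le k f0] by simp
  qed
  have idx: "idx N J i \<in> insert 0 J" if "i \<le> card J" for i
    using st.pi_in[of i] st.pi_0 that by (cases "i = 0") auto
  have v_cell: "v J t x = st.mass i / (st.pos (Suc i) t - st.pos i t)"
    if "t \<in> {s..<e}" "i \<le> card J" "st.pos i t < x" "x < st.pos (Suc i) t" for t i x
    unfolding v_def using st.profile_on_cell[OF _ that(2-4) subset_refl idx[OF that(2)]] that(1)
      st.density_eq[OF that(2,1)] by simp
  have F_eq: "F t = (\<Sum>i\<le>card J. ps.rate i t)" if t: "t \<in> {s<..<e}" for t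
    unfolding F_def
  proof (rule ps.space_integral_eq_sum_rate[OF t])
    fix i x assume x: "i \<le> card J" "st.pos i t < x" "x < st.pos (Suc i) t"
    show "v J t x = st.mass i / (st.pos (Suc i) t - st.pos i t)" using v_cell[OF _ x] t by simp
    assume "st.mass i \<noteq> 0"
    then have "i \<in> {1..<card J}" unfolding st.mass_def by (meson)
    then show "a t x = (st.pos (Suc i) t - x) / (st.pos (Suc i) t - st.pos i t) * st.vel i t +
        (x - st.pos i t) / (st.pos (Suc i) t - st.pos i t) * st.vel (Suc i) t"
      unfolding a_def using x t by (intro st.velocity_on_cell) auto
  qed
  show "set_integrable lborel {s<..<e} F"
    using ps.stage_inequality(1)
    by (rule set_integrable_cong[THEN iffD1, rotated -1]) (simp_all add: F_eq)
  have "(LBINT x. \<phi> x s * \<bar>v J s x - k\<bar>) = (\<Sum>i\<le>card J. ps.content i s)"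
    by (subst ps.space_integral_eq_sum_content[OF se(1) v_cell[OF se(3)]])
       (auto intro!: sum.cong simp: st.pos_less[OF _ se(3)])
  moreover have "(LBINT x. \<phi> x e * \<bar>v J' e x - k\<bar>) \<le> (\<Sum>i\<le>card J. ps.content i e)"
  proof -
    have "v J' e x = st.mass i / (st.pos (Suc i) e - st.pos i e)"
      if i: "i \<le> card J" and x: "st.pos i e < x" "x < st.pos (Suc i) e" for i x
    proof -
      have less: "st.pos i e < st.pos (Suc i) e" using x by simp
      have "idx N J i \<in> insert 0 J'"
        using st.survives[OF _ less] st.pi_0 i by (cases "i = 0") auto
      then show ?thesis
        unfolding v_def using st.profile_on_cell[OF se(2) i x st.survivors(1)] st.density_eq_end[OF i less]
        by simp
    qed
    then have "(LBINT x. \<phi> x e * \<bar>v J' e x - k\<bar>) =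
        (\<Sum>i\<le>card J. if st.pos i e < st.pos (Suc i) e then ps.content i e else 0)"
      by (rule ps.space_integral_eq_sum_content[OF se(2)])
    also have "\<dots> \<le> (\<Sum>i\<le>card J. ps.content i e)"
      by (rule sum_mono) (simp add: ps.content_nonneg[OF _ se(2)])
    finally show ?thesis .
  qed
  moreover have "(LBINT t:{s<..<e}. F t) = (LBINT t:{s<..<e}. \<Sum>i\<le>card J. ps.rate i t)"
    by (rule set_lebesgue_integral_cong) (simp_all add: F_eq)
  ultimately show "(LBINT x. \<phi> x e * \<bar>v J' e x - k\<bar>) - (LBINT x. \<phi> x s * \<bar>v J s x - k\<bar>)
      \<le> (LBINT t:{s<..<e}. F t)"
    using ps.stage_inequality(2) by linarith
qed

lemma stage_of_eq:
  assumes mono: "\<And>i. i < M \<Longrightarrow> \<tau> i < \<tau> (Suc i)"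
    and j: "j \<le> M" "\<tau> j \<le> t" "j < M \<Longrightarrow> t < \<tau> (Suc j)"
  shows "stage_of M \<tau> t = j"
  unfolding stage_of_def
proof (rule Max_eqI)
  have le: "\<tau> a \<le> \<tau> b" if "a \<le> b" "b \<le> M" for a b
    using that
  proof (induction b rule: dec_induct)
    case (step b)
    then show ?case using mono[of b] by simp
  qed simp
  fix i assume i: "i \<in> {i. i \<le> M \<and> \<tau> i \<le> t}"
  show "i \<le> j"
  proof (rule ccontr)
    assume "\<not> i \<le> j"
    then show False using le[of "Suc j" i] j i by auto
  qed
qed (use j in auto)

lemma set_integral_insert_point:
  fixes g :: "real \<Rightarrow> real"
  shows "set_integrable lborel (insert a A) g \<longleftrightarrow> set_integrable lborel A g"
    and "(LBINT t:insert a A. g t) = (LBINT t:A. g t)"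
  unfolding set_integrable_def set_lebesgue_integral_def
  by (intro integrable_discrete_difference[where X = "{a}"] integral_discrete_difference[where X = "{a}"];
      auto simp: indicator_def)+

lemma ex_position_bound:
  assumes stage: "scheme_stage f T N X W s e J J'" and J: "J \<subseteq> {1..N}"
  shows "\<exists>B>R. \<forall>i\<in>J. \<forall>t\<in>{s..e}. \<bar>X i t\<bar> < B"
proof -
  have "\<exists>b. \<forall>t\<in>{s..e}. \<bar>X i t\<bar> \<le> b" if i: "i \<in> J" for i
  proof -
    obtain i' where "i' \<in> {1..card J}" "idx N J i' = i" using ex_idx[OF J i] .
    then have cont: "continuous_on {s..e} (X i)"
      using stage unfolding scheme_stage_def Let_def by blast
    show ?thesis
      using compact_imp_bounded[OF compact_continuous_image[OF cont compact_Icc]]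
      unfolding bounded_iff image_iff real_norm_def by blast
  qed
  then obtain b where b: "\<And>i t. i \<in> J \<Longrightarrow> t \<in> {s..e} \<Longrightarrow> \<bar>X i t\<bar> \<le> b i" by metis
  have "b i \<le> Max (insert R (b ` J))" if "i \<in> J" for i
    using that finite_indices[OF J] by (intro Max_ge) auto
  moreover have "R \<le> Max (insert R (b ` J))"
    using finite_indices[OF J] by (intro Max_ge) auto
  ultimately show ?thesis
    using b by (intro exI[of _ "Max (insert R (b ` J)) + 1"]) (fastforce intro: order_trans le_less_trans)
qed

text \<open>Induction over the stages: the particles left by one stage are separated, as the next one
  requires.\<close>

lemma scheme_run_stages:
  assumes lip: "L-lipschitz_on UNIV f" and f0: "f 0 = 0" and diff: "f differentiable (at 0)"
    and N: "N \<ge> 1" and p: "strict_mono_on {1..N} p"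
    and scheme: "particle_path_scheme f T N p u\<^sub>0 M \<tau> I X W"
    and j: "j < M"
  shows "\<exists>B\<ge>R. scheme_run_stage f T N X W (\<tau> j) (\<tau> (Suc j)) (I j) (I (Suc j)) L B"
proof -
  have stage: "scheme_stage f T N X W (\<tau> j) (\<tau> (Suc j)) (I j) (I (Suc j))" if "j < M" for j
    using scheme that unfolding particle_path_scheme_def by blast
  have ends: "W 0 t = 0 \<and> W N t = 0" if "t \<in> {0..T}" for t
    using scheme that unfolding particle_path_scheme_def by blast
  have run: "\<exists>B\<ge>R. scheme_run_stage f T N X W (\<tau> j) (\<tau> (Suc j)) (I j) (I (Suc j)) L B"
    if j: "j < M" "I j \<subseteq> {1..N}" "N \<in> I j" "0 \<le> \<tau> j" "strict_mono_on (I j) (\<lambda>i. X i (\<tau> j))" for j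
  proof -
    obtain B where B: "B > R" "\<forall>i\<in>I j. \<forall>t\<in>{\<tau> j..\<tau> (Suc j)}. \<bar>X i t\<bar> < B"
      using ex_position_bound[OF stage[OF j(1)] j(2)] by blast
    have "scheme_run_stage f T N X W (\<tau> j) (\<tau> (Suc j)) (I j) (I (Suc j)) L B"
      using j stage[OF j(1)] ends B abs_speed_le[OF lip f0 diff] by unfold_locales auto
    then show ?thesis using B(1) by (intro exI[of _ B]) simp
  qed
  have "I j \<subseteq> {1..N} \<and> N \<in> I j \<and> 0 \<le> \<tau> j \<and> strict_mono_on (I j) (\<lambda>i. X i (\<tau> j))" if "j \<le> M" for j
    using that
  proof (induction j)
    case 0
    have "strict_mono_on {1..N} (\<lambda>i. X i 0)"
      using scheme p unfolding particle_path_scheme_def strict_mono_on_def by simp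
    then show ?case using scheme N unfolding particle_path_scheme_def by simp
  next
    case (Suc j)
    then obtain B where "scheme_run_stage f T N X W (\<tau> j) (\<tau> (Suc j)) (I j) (I (Suc j)) L B"
      using run[of j] by auto
    then interpret st: scheme_run_stage f T N X W "\<tau> j" "\<tau> (Suc j)" "I j" "I (Suc j)" L B .
    show ?case using st.survivors st.J st.s_nonneg st.stage_times by auto
  qed
  then show ?thesis using run j by simp
qed

theorem theorem5p7:
  fixes f u\<^sub>0 :: "real \<Rightarrow> real" and T :: real and N :: nat and p :: "nat \<Rightarrow> real"
    and M :: nat and \<tau> :: "nat \<Rightarrow> real" and I :: "nat \<Rightarrow> nat set"
    and X W :: "nat \<Rightarrow> real \<Rightarrow> real"
    and v A :: "real \<Rightarrow> real \<Rightarrow> real" and v\<^sub>0 :: "real \<Rightarrow> real"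
  assumes "T > 0"
    and "\<exists>L. L-lipschitz_on UNIV f" and "f 0 = 0" and "f differentiable (at 0)"
    and "BV u\<^sub>0" and "integrable lebesgue u\<^sub>0" and "AE x in lebesgue. u\<^sub>0 x \<ge> 0"
    and "N \<ge> 1" and "strict_mono_on {1..N} p"
    and "particle_path_scheme f T N p u\<^sub>0 M \<tau> I X W"
    and "v = approximation N M \<tau> I X W"
    and "v\<^sub>0 = profile N {1..N} p (init_density N p u\<^sub>0)"
    and "A = velocity_field f N M \<tau> I X W"
  shows "\<forall>k\<ge>0. \<forall>\<phi>. test_function T \<phi> \<and> (\<forall>x. \<forall>t\<in>{0..T}. \<phi> x t \<ge> 0) \<longrightarrow>
    (LBINT t:{0..T}. (LBINT x.
        \<bar>v x t - k\<bar> * deriv (\<lambda>s. \<phi> x s) t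
        + (A x t * v x t - f k) * sgn (v x t - k) * deriv (\<lambda>y. \<phi> y t) x))
    - (LBINT x. \<phi> x T * \<bar>v x T - k\<bar>)
    + (LBINT x. \<phi> x 0 * \<bar>v\<^sub>0 x - k\<bar>) \<ge> 0"
proof (intro allI impI, elim conjE)
  fix k :: real and \<phi> :: "real \<Rightarrow> real \<Rightarrow> real"
  assume k: "0 \<le> k" and test: "test_function T \<phi>" and pos: "\<forall>x. \<forall>t\<in>{0..T}. 0 \<le> \<phi> x t"
  obtain L where L: "L-lipschitz_on UNIV f" using assms(2) by blast
  note scheme = assms(10)
  obtain \<phi>x \<phi>t R where strip: "strip_test_function T \<phi> \<phi>x \<phi>t R" and R: "0 \<le> R"
    using test_function_strip[OF assms(1) test pos] .
  interpret strip_test_function T \<phi> \<phi>x \<phi>t R by (fact strip)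
  note run = scheme_run_stages[OF L assms(3,4,8,9) scheme]
  have \<tau>: "\<tau> 0 = 0" "\<tau> M = T" and I0: "I 0 = {1..N}"
    using scheme unfolding particle_path_scheme_def by auto
  have \<tau>_less: "\<tau> j < \<tau> (Suc j)" and \<tau>_bounds: "0 \<le> \<tau> j" "\<tau> (Suc j) \<le> T" if j: "j < M" for j
  proof -
    obtain B where "scheme_run_stage f T N X W (\<tau> j) (\<tau> (Suc j)) (I j) (I (Suc j)) L B"
      using run[OF j] by blast
    then interpret st: scheme_run_stage f T N X W "\<tau> j" "\<tau> (Suc j)" "I j" "I (Suc j)" L B .
    show "\<tau> j < \<tau> (Suc j)" "0 \<le> \<tau> j" "\<tau> (Suc j) \<le> T" using st.s_nonneg st.stage_times by auto
  qed
  note stage_of = stage_of_eq[where M = M and \<tau> = \<tau>, OF \<tau>_less]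
  define F where "F t = (LBINT x. \<bar>v x t - k\<bar> * deriv (\<lambda>s. \<phi> x s) t
        + (A x t * v x t - f k) * sgn (v x t - k) * deriv (\<lambda>y. \<phi> y t) x)" for t
  define G where "G j = (LBINT x. \<phi> x (\<tau> j) *
      \<bar>profile N (I j) (\<lambda>i. X i (\<tau> j)) (\<lambda>i. W i (\<tau> j)) x - k\<bar>)" for j
  have stage: "set_integrable lborel {\<tau> j..<\<tau> (Suc j)} F \<and>
      G (Suc j) - G j \<le> (LBINT t:{\<tau> j..<\<tau> (Suc j)}. F t)" if j: "j < M" for j
  proof -
    obtain B where B: "B \<ge> R" and st: "scheme_run_stage f T N X W (\<tau> j) (\<tau> (Suc j)) (I j) (I (Suc j)) L B"
      using run[OF j] by blast
    let ?v = "\<lambda>t. profile N (I j) (\<lambda>i. X i t) (\<lambda>i. W i t)"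
    let ?a = "\<lambda>t. interpolated_velocity f N (I j) (\<lambda>i. X i t) (\<lambda>i. W i t)"
    let ?F = "\<lambda>t. LBINT x. \<bar>?v t x - k\<bar> * \<phi>t x t + (?a t x * ?v t x - f k) * sgn (?v t x - k) * \<phi>x x t"
    have F_eq: "F t = ?F t" if t: "t \<in> {\<tau> j<..<\<tau> (Suc j)}" for t
    proof -
      have t': "t \<in> {0..T}" "0 < t" "t < T" using t \<tau>_bounds[OF j] by auto
      have "stage_of M \<tau> t = j" using t j by (intro stage_of) auto
      then have vA: "v x t = ?v t x" "A x t = ?a t x" for x
        unfolding assms(11,13) approximation_def velocity_field_def by simp_all
      have "((\<lambda>s. \<phi> x s) has_real_derivative \<phi>t x t) (at t)" for x
        using deriv_t[OF t'(1), of x] t' at_within_Icc_at[of 0 t T] by simp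
      then have "deriv (\<lambda>s. \<phi> x s) t = \<phi>t x t" for x by (rule DERIV_imp_deriv)
      moreover have "deriv (\<lambda>y. \<phi> y t) x = \<phi>x x t" for x
        using deriv_x[OF t'(1)] by (rule DERIV_imp_deriv)
      ultimately show ?thesis unfolding F_def vA by simp
    qed
    note ineq = stage_entropy_inequality[OF st R B k assms(3)]
    have "set_integrable lborel {\<tau> j<..<\<tau> (Suc j)} F"
      using ineq(1) by (rule set_integrable_cong[THEN iffD1, rotated -1]) (simp_all add: F_eq)
    moreover have "(LBINT t:{\<tau> j<..<\<tau> (Suc j)}. F t) = (LBINT t:{\<tau> j<..<\<tau> (Suc j)}. ?F t)"
      by (rule set_lebesgue_integral_cong) (simp_all add: F_eq)
    moreover have "{\<tau> j..<\<tau> (Suc j)} = insert (\<tau> j) {\<tau> j<..<\<tau> (Suc j)}"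
      using \<tau>_less[OF j] by auto
    ultimately show ?thesis using ineq(2) by (simp add: set_integral_insert_point G_def)
  qed
  \<comment> \<open>Half-open time intervals make the stages disjoint and the start of the induction trivial.\<close>
  have "set_integrable lborel {0..<\<tau> j} F \<and> G j - G 0 \<le> (LBINT t:{0..<\<tau> j}. F t)" if "j \<le> M" for j
    using that
  proof (induction j)
    case 0
    then show ?case by (simp add: \<tau> set_integrable_def set_lebesgue_integral_def)
  next
    case (Suc j)
    then have j: "j < M" and IH: "set_integrable lborel {0..<\<tau> j} F"
      "G j - G 0 \<le> (LBINT t:{0..<\<tau> j}. F t)" by auto
    have un: "{0..<\<tau> (Suc j)} = {0..<\<tau> j} \<union> {\<tau> j..<\<tau> (Suc j)}"
      using \<tau>_less[OF j] \<tau>_bounds[OF j] by auto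
    have "set_integrable lborel {0..<\<tau> (Suc j)} F"
      unfolding un using stage[OF j] IH by (intro set_integrable_Un) auto
    moreover have "(LBINT t:{0..<\<tau> (Suc j)}. F t) =
        (LBINT t:{0..<\<tau> j}. F t) + (LBINT t:{\<tau> j..<\<tau> (Suc j)}. F t)"
      unfolding un using stage[OF j] IH by (intro set_integral_Un) auto
    ultimately show ?case using stage[OF j] IH(2) by linarith
  qed
  then have total: "G M - G 0 \<le> (LBINT t:{0..<T}. F t)" using \<tau> by auto
  have "{0..T} = insert T {0..<T}" using assms(1) by auto
  then have "(LBINT t:{0..T}. F t) = (LBINT t:{0..<T}. F t)"
    by (simp add: set_integral_insert_point)
  moreover have "(LBINT x. \<phi> x T * \<bar>v x T - k\<bar>) = G M"
  proof -
    have "stage_of M \<tau> T = M" using \<tau> by (intro stage_of) auto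
    then show ?thesis unfolding G_def assms(11) approximation_def by (simp add: \<tau>)
  qed
  moreover have "(LBINT x. \<phi> x 0 * \<bar>v\<^sub>0 x - k\<bar>) = G 0"
  proof -
    have J: "{1..N} \<subseteq> {1..N}" by simp
    have X: "X i 0 = p i" if "i \<in> {1..N}" for i
      using scheme that unfolding particle_path_scheme_def by blast
    have W: "W i 0 = init_density N p u\<^sub>0 i" if "i \<in> {0..N}" for i
      using scheme that unfolding particle_path_scheme_def by blast
    have idx_le: "idx N {1..N} i \<in> {0..N}" if "i \<in> {0..N}" for i
      using idx_in[OF J, of i] that by (cases "i = 0") (auto simp: idx_def)
    have ext_p: "ext_pos N (\<lambda>i. X i 0) i = ext_pos N p i" for i
      using X by (simp add: ext_pos_def)
    have "profile N {1..N} (\<lambda>i. X i 0) (\<lambda>i. W i 0) = v\<^sub>0"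
      unfolding assms(12) profile_def ext_p
      by (intro ext sum.cong refl arg_cong2[where f = "(*)"] W idx_le) auto
    then show ?thesis unfolding G_def \<tau> I0 by simp
  qed
  ultimately show "0 \<le> (LBINT t:{0..T}. (LBINT x. \<bar>v x t - k\<bar> * deriv (\<lambda>s. \<phi> x s) t
        + (A x t * v x t - f k) * sgn (v x t - k) * deriv (\<lambda>y. \<phi> y t) x))
    - (LBINT x. \<phi> x T * \<bar>v x T - k\<bar>) + (LBINT x. \<phi> x 0 * \<bar>v\<^sub>0 x - k\<bar>)"
    using total unfolding F_def[symmetric] by linarith
qed

end
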